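(* Let $n\ge 3$ and let $M$ be an indecomposable object of $\operatorname{mod}(T(n),\Omega)$. Then $M\in \mathrm{GR}$ if and only if $M\in \mathrm{Inj}\cup\mathrm{Surj}$; that is, on indecomposable modules in $\operatorname{mod}(T(n),\Omega)$ one has $\mathrm{GR}=\mathrm{Inj}\cup\mathrm{Surj}$.
   Context: Let $k$ be an algebraically closed field. $K(n)$ is the generalized Kronecker quiver with vertices $1,2$ and $n$ arrows $\gamma_1,\dots,\gamma_n:1\to 2$. Its universal covering $(T(n),\Omega)$ is the (infinite) $n$-regular tree with bipartite orientation $\Omega$ (each vertex is a source or a sink), together with the covering map $\pi:T(n)\to K(n)$ sending sources to $1$, sinks to $2$ and each arrow to some $\gamma_i$ (its label), so that at each vertex there is exactly one incident arrow of each label $\gamma_1,\dots,\gamma_n$. $\operatorname{mod}(T(n),\Omega)$ is the category of finite-dimensional $k$-linear representations $M=((M_x)_{x\in T(n)_0},(M(\delta))_{\delta\in T(n)_1})$ of $(T(n),\Omega)$ (total dimension finite). The push-down functor $\pi_\lambda$ sends $M$ to the representation of $K(n)$ with $\pi_\lambda(M)_j=\bigoplus_{\pi(y)=j}M_y$ $(j=1,2)$ and $\pi_\lambda(M)(\gamma_i)=\bigoplus_{\pi(\beta)=\gamma_i}M(\beta)$. A finite-dimensional representation $N$ of $K(n)$ is of constant rank if the rank of $x^\alpha_N=\sum_{i=1}^n\alpha_iN(\gamma_i):N_1\to N_2$ is the same for all $\alpha\in k^n\setminus\{0\}$. $\mathrm{Inj}$ (resp. $\mathrm{Surj}$) is the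 class of $M\in\operatorname{mod}(T(n),\Omega)$ such that $M(\delta)$ is injective (resp. surjective) for all arrows $\delta\in T(n)_1$. $\mathrm{GR}$ is the class of $M\in\operatorname{mod}(T(n),\Omega)$ such that $\pi_\lambda(M)$ is of constant rank. *)

theory Defs
  imports
    "Graph_Theory.Digraph_Component"
    "HOL-Library.Function_Algebras"
    "HOL-Computational_Algebra.Polynomial"
begin

section \<open>Quivers and coverings\<close>

text \<open>
  A quiver is a well-formed \<^typ>\<open>('v, 'e) pre_digraph\<close>. The library's notion of a tree only
  excludes directed cycles, which a bipartite orientation never has; here the underlying
  undirected graph must be a tree. Each arc is therefore doubled, \<open>(e, True)\<close> being \<open>e\<close> itself
  and \<open>(e, False)\<close> its formal inverse, and a cycle of the underlying graph is a cycle of the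
  doubled quiver that uses no arc twice (in either direction). Loops and pairs of parallel arcs
  count as cycles.
\<close>

definition doubled :: "('v, 'e) pre_digraph \<Rightarrow> ('v, 'e \<times> bool) pre_digraph" where
  "doubled Q = \<lparr> verts = verts Q, arcs = arcs Q \<times> UNIV,
     tail = (\<lambda>(e, b). if b then tail Q e else head Q e),
     head = (\<lambda>(e, b). if b then head Q e else tail Q e) \<rparr>"

definition tree_quiver :: "('v, 'e) pre_digraph \<Rightarrow> bool" where
  "tree_quiver Q \<longleftrightarrow> wf_digraph Q \<and> connected Q \<and>
     \<not> (\<exists>p. pre_digraph.cycle (doubled Q) p \<and> distinct (map fst p))"

definition quiver_morphism ::
  "('v, 'e) pre_digraph \<Rightarrow> ('w, 'f) pre_digraph \<Rightarrow> ('v \<Rightarrow> 'w) \<Rightarrow> ('e \<Rightarrow> 'f) \<Rightarrow> bool" where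
  "quiver_morphism Q R \<pi>\<^sub>0 \<pi>\<^sub>1 \<longleftrightarrow>
     \<pi>\<^sub>0 ` verts Q \<subseteq> verts R \<and> \<pi>\<^sub>1 ` arcs Q \<subseteq> arcs R \<and>
     (\<forall>e\<in>arcs Q. tail R (\<pi>\<^sub>1 e) = \<pi>\<^sub>0 (tail Q e) \<and> head R (\<pi>\<^sub>1 e) = \<pi>\<^sub>0 (head Q e))"

definition quiver_covering ::
  "('v, 'e) pre_digraph \<Rightarrow> ('w, 'f) pre_digraph \<Rightarrow> ('v \<Rightarrow> 'w) \<Rightarrow> ('e \<Rightarrow> 'f) \<Rightarrow> bool" where
  "quiver_covering Q R \<pi>\<^sub>0 \<pi>\<^sub>1 \<longleftrightarrow>
     quiver_morphism Q R \<pi>\<^sub>0 \<pi>\<^sub>1 \<and> \<pi>\<^sub>0 ` verts Q = verts R \<and>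
     (\<forall>x\<in>verts Q. bij_betw \<pi>\<^sub>1 (out_arcs Q x) (out_arcs R (\<pi>\<^sub>0 x)) \<and>
                   bij_betw \<pi>\<^sub>1 (in_arcs Q x) (in_arcs R (\<pi>\<^sub>0 x)))"

definition universal_covering ::
  "('v, 'e) pre_digraph \<Rightarrow> ('w, 'f) pre_digraph \<Rightarrow> ('v \<Rightarrow> 'w) \<Rightarrow> ('e \<Rightarrow> 'f) \<Rightarrow> bool" where
  "universal_covering Q R \<pi>\<^sub>0 \<pi>\<^sub>1 \<longleftrightarrow> tree_quiver Q \<and> quiver_covering Q R \<pi>\<^sub>0 \<pi>\<^sub>1"

text \<open>The arrow \<open>\<gamma>\<^sub>i\<close> of the generalized Kronecker quiver is encoded by its index \<open>i\<close>.\<close>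

definition kronecker :: "nat \<Rightarrow> (nat, nat) pre_digraph" where
  "kronecker n = \<lparr> verts = {1, 2}, arcs = {1..n}, tail = (\<lambda>_. 1), head = (\<lambda>_. 2) \<rparr>"

text \<open>
  Over \<^term>\<open>kronecker n\<close>, the covering condition says that the source and target fibres consist of
  sources and sinks, respectively, and that every vertex meets exactly one arrow of each label.
\<close>

lemma bij_betw_ex1:
  assumes "bij_betw f A B" "y \<in> B"
  shows "\<exists>!x. x \<in> A \<and> f x = y"
proof -
  obtain x where "x \<in> A" "f x = y" using assms by (auto simp: bij_betw_def)
  then show ?thesis using assms(1) by (auto simp: bij_betw_def dest: inj_onD)
qed

lemma universal_covering_kronecker_iff:
  assumes "n \<ge> 1"
  shows "universal_covering Q (kronecker n) \<pi>\<^sub>0 \<pi>\<^sub>1 \<longleftrightarrow>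
    tree_quiver Q \<and> \<pi>\<^sub>0 ` verts Q \<subseteq> {1, 2} \<and> \<pi>\<^sub>1 ` arcs Q \<subseteq> {1..n} \<and>
    (\<forall>e\<in>arcs Q. \<pi>\<^sub>0 (tail Q e) = 1 \<and> \<pi>\<^sub>0 (head Q e) = 2) \<and>
    (\<forall>x\<in>verts Q. \<forall>i\<in>{1..n}. \<exists>!e. e \<in> arcs Q \<and> (tail Q e = x \<or> head Q e = x) \<and> \<pi>\<^sub>1 e = i)"
    (is "?L \<longleftrightarrow> ?R")
proof
  assume L: ?L
  have star: "\<exists>!e. e \<in> arcs Q \<and> (tail Q e = x \<or> head Q e = x) \<and> \<pi>\<^sub>1 e = i"
    if "x \<in> verts Q" "i \<in> {1..n}" for x i
  proof -
    have arcs: "\<forall>e\<in>arcs Q. \<pi>\<^sub>0 (tail Q e) = 1 \<and> \<pi>\<^sub>0 (head Q e) = 2"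
      and "\<pi>\<^sub>0 x = 1 \<or> \<pi>\<^sub>0 x = 2"
      and out: "bij_betw \<pi>\<^sub>1 (out_arcs Q x) (out_arcs (kronecker n) (\<pi>\<^sub>0 x))"
      and inn: "bij_betw \<pi>\<^sub>1 (in_arcs Q x) (in_arcs (kronecker n) (\<pi>\<^sub>0 x))"
      using L that
      by (auto simp: universal_covering_def quiver_covering_def quiver_morphism_def kronecker_def)
    have kron: "out_arcs (kronecker n) 1 = {1..n}" "in_arcs (kronecker n) 2 = {1..n}"
      by (auto simp: kronecker_def out_arcs_def in_arcs_def)
    from \<open>\<pi>\<^sub>0 x = 1 \<or> \<pi>\<^sub>0 x = 2\<close> consider "\<pi>\<^sub>0 x = 1" | "\<pi>\<^sub>0 x = 2" by blast
    then show ?thesis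
    proof cases
      case 1
      then have "bij_betw \<pi>\<^sub>1 (out_arcs Q x) {1..n}"
        using out kron by simp
      then have "\<exists>!e. e \<in> out_arcs Q x \<and> \<pi>\<^sub>1 e = i"
        using that(2) by (rule bij_betw_ex1)
      then show ?thesis using arcs 1 by (auto simp: out_arcs_def)
    next
      case 2
      then have "bij_betw \<pi>\<^sub>1 (in_arcs Q x) {1..n}"
        using inn kron by simp
      then have "\<exists>!e. e \<in> in_arcs Q x \<and> \<pi>\<^sub>1 e = i"
        using that(2) by (rule bij_betw_ex1)
      then show ?thesis using arcs 2 by (auto simp: in_arcs_def)
    qed
  qed
  show ?R
    using L star
    by (auto simp: universal_covering_def quiver_covering_def quiver_morphism_def kronecker_def)
next
  assume R: ?R
  then have T: "tree_quiver Q" and v: "\<pi>\<^sub>0 ` verts Q \<subseteq> {1, 2}" and l: "\<pi>\<^sub>1 ` arcs Q \<subseteq> {1..n}"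
    and arcs: "\<And>e. e \<in> arcs Q \<Longrightarrow> \<pi>\<^sub>0 (tail Q e) = 1 \<and> \<pi>\<^sub>0 (head Q e) = 2"
    and star: "\<And>x i. x \<in> verts Q \<Longrightarrow> i \<in> {1..n} \<Longrightarrow>
      \<exists>!e. e \<in> arcs Q \<and> (tail Q e = x \<or> head Q e = x) \<and> \<pi>\<^sub>1 e = i"
    by auto
  interpret wf_digraph Q using T by (simp add: tree_quiver_def)
  obtain x where "x \<in> verts Q"
    using T by (auto simp: tree_quiver_def connected_def strongly_connected_def mk_symmetric_def)
  moreover have "1 \<in> {1..n}" using assms by simp
  ultimately have "\<exists>!e. e \<in> arcs Q \<and> (tail Q e = x \<or> head Q e = x) \<and> \<pi>\<^sub>1 e = 1" by (rule star)
  then obtain e where e: "e \<in> arcs Q" by (elim ex1E conjE)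
  then have "1 \<in> \<pi>\<^sub>0 ` verts Q" "2 \<in> \<pi>\<^sub>0 ` verts Q"
    using arcs[OF e] tail_in_verts[OF e] head_in_verts[OF e] by (metis imageI)+
  then have surj: "\<pi>\<^sub>0 ` verts Q = {1, 2}" using v by blast
  have bij: "bij_betw \<pi>\<^sub>1 (out_arcs Q x) (out_arcs (kronecker n) (\<pi>\<^sub>0 x)) \<and>
    bij_betw \<pi>\<^sub>1 (in_arcs Q x) (in_arcs (kronecker n) (\<pi>\<^sub>0 x))" if x: "x \<in> verts Q" for x
  proof -
    have inj: "inj_on \<pi>\<^sub>1 {e \<in> arcs Q. tail Q e = x \<or> head Q e = x}"
    proof (rule inj_onI)
      fix d e assume "d \<in> {e \<in> arcs Q. tail Q e = x \<or> head Q e = x}"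
        "e \<in> {e \<in> arcs Q. tail Q e = x \<or> head Q e = x}" "\<pi>\<^sub>1 d = \<pi>\<^sub>1 e"
      then have de: "d \<in> arcs Q \<and> (tail Q d = x \<or> head Q d = x) \<and> \<pi>\<^sub>1 d = \<pi>\<^sub>1 e"
        "e \<in> arcs Q \<and> (tail Q e = x \<or> head Q e = x) \<and> \<pi>\<^sub>1 e = \<pi>\<^sub>1 e" by simp_all
      have "\<pi>\<^sub>1 e \<in> {1..n}" using de l by blast
      then obtain c where c: "\<forall>a. a \<in> arcs Q \<and> (tail Q a = x \<or> head Q a = x) \<and> \<pi>\<^sub>1 a = \<pi>\<^sub>1 e
          \<longrightarrow> a = c"
        by (rule star[OF x, THEN ex1E])
      show "d = e" using c[rule_format, OF de(1)] c[rule_format, OF de(2)] by simp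
    qed
    have im: "\<pi>\<^sub>1 ` {e \<in> arcs Q. tail Q e = x \<or> head Q e = x} = {1..n}"
    proof
      show "{1..n} \<subseteq> \<pi>\<^sub>1 ` {e \<in> arcs Q. tail Q e = x \<or> head Q e = x}"
      proof
        fix i assume "i \<in> {1..n}"
        from ex1_implies_ex[OF star[OF x this]]
        obtain e where "e \<in> arcs Q" "tail Q e = x \<or> head Q e = x" "\<pi>\<^sub>1 e = i" by blast
        then show "i \<in> \<pi>\<^sub>1 ` {e \<in> arcs Q. tail Q e = x \<or> head Q e = x}" by blast
      qed
    qed (use l in auto)
    consider "\<pi>\<^sub>0 x = 1" | "\<pi>\<^sub>0 x = 2" using v x by blast
    then show ?thesis
    proof cases
      case 1
      then have "out_arcs Q x = {e \<in> arcs Q. tail Q e = x \<or> head Q e = x}" "in_arcs Q x = {}"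
        using arcs by (auto simp: out_arcs_def in_arcs_def)
      moreover have "out_arcs (kronecker n) (\<pi>\<^sub>0 x) = {1..n}" "in_arcs (kronecker n) (\<pi>\<^sub>0 x) = {}"
        unfolding 1 by (auto simp: kronecker_def out_arcs_def in_arcs_def)
      ultimately show ?thesis using inj im
        by (simp only: bij_betw_def image_empty inj_on_empty simp_thms)
    next
      case 2
      then have "in_arcs Q x = {e \<in> arcs Q. tail Q e = x \<or> head Q e = x}" "out_arcs Q x = {}"
        using arcs by (auto simp: out_arcs_def in_arcs_def)
      moreover have "in_arcs (kronecker n) (\<pi>\<^sub>0 x) = {1..n}" "out_arcs (kronecker n) (\<pi>\<^sub>0 x) = {}"
        unfolding 2 by (auto simp: kronecker_def out_arcs_def in_arcs_def)
      ultimately show ?thesis using inj im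
        by (simp only: bij_betw_def image_empty inj_on_empty simp_thms)
    qed
  qed
  show ?L
    using T l arcs surj bij
    by (auto simp: universal_covering_def quiver_covering_def quiver_morphism_def kronecker_def)
qed

text \<open>
  The universal covering exists: its vertices are the words over the labels without two equal
  adjacent letters, and the word \<open>i # w\<close> is joined to \<open>w\<close> by an arc with label \<open>i\<close>, encoded
  as \<open>i # w\<close> itself.
\<close>

definition reduced_words :: "nat \<Rightarrow> nat list set" where
  "reduced_words n = {w. set w \<subseteq> {1..n} \<and> distinct_adj w}"

definition word_tree :: "nat \<Rightarrow> (nat list, nat list) pre_digraph" where
  "word_tree n = \<lparr> verts = reduced_words n, arcs = reduced_words n - {[]},
     tail = (\<lambda>w. if even (length w) then w else tl w),
     head = (\<lambda>w. if even (length w) then tl w else w) \<rparr>"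

lemma reduced_words_tl: "w \<in> reduced_words n \<Longrightarrow> tl w \<in> reduced_words n"
  by (cases w) (auto simp: reduced_words_def distinct_adj_Cons)

lemma wf_word_tree: "wf_digraph (word_tree n)"
  by unfold_locales (auto simp: word_tree_def reduced_words_tl)

lemma connected_word_tree: "connected (word_tree n)"
proof -
  let ?S = "with_proj (mk_symmetric (word_tree n))"
  interpret S: wf_digraph ?S
    by unfold_locales (auto simp: mk_symmetric_def word_tree_def reduced_words_tl split: if_splits)
  have adj: "w \<rightarrow>\<^bsub>?S\<^esub> tl w \<and> tl w \<rightarrow>\<^bsub>?S\<^esub> w" if "w \<in> reduced_words n" "w \<noteq> []" for w
    using that by (auto simp: arcs_ends_conv mk_symmetric_def word_tree_def image_iff
        split: if_splits)
  have root: "w \<rightarrow>\<^sup>*\<^bsub>?S\<^esub> [] \<and> [] \<rightarrow>\<^sup>*\<^bsub>?S\<^esub> w" if "w \<in> reduced_words n" for w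
    using that
  proof (induction w)
    case Nil
    then have "[] \<in> verts ?S" by (simp add: mk_symmetric_def word_tree_def)
    then show ?case by simp
  next
    case (Cons i w)
    then show ?case
      using reduced_words_tl[OF Cons.prems] adj[OF Cons.prems]
      by (auto intro: S.adj_reachable_trans S.reachable_adj_trans)
  qed
  moreover have "verts ?S = reduced_words n" "[] \<in> reduced_words n"
    by (auto simp: mk_symmetric_def word_tree_def reduced_words_def)
  ultimately show ?thesis
    unfolding connected_def strongly_connected_def
    using S.reachable_trans by blast
qed

lemma acyclic_word_tree:
  "\<not> (\<exists>p. pre_digraph.cycle (doubled (word_tree n)) p \<and> distinct (map fst p))"
proof
  define D where "D = doubled (word_tree n)"
  interpret pre_digraph D .
  assume "\<exists>p. pre_digraph.cycle (doubled (word_tree n)) p \<and> distinct (map fst p)"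
  then obtain p u where p: "cas u p u" "p \<noteq> []" "distinct (map fst p)" "set p \<subseteq> arcs D"
    unfolding D_def[symmetric] cycle_def awalk_def by blast
  have ends: "{tail D a, head D a} = {fst a, tl (fst a)}" if "a \<in> arcs D" for a
    using that by (cases a) (auto simp: D_def doubled_def word_tree_def)
  have cas_app: "cas v (q @ r) w \<longleftrightarrow> (\<exists>z. cas v q z \<and> cas z r w)" for v q r w
    by (induction q arbitrary: v) auto
  define m where "m = Max ((length \<circ> fst) ` set p)"
  have "m \<in> (length \<circ> fst) ` set p"
    unfolding m_def using p(2) by (intro Max_in) auto
  then obtain a where a: "a \<in> set p" "length (fst a) = m" by auto
  then have max: "length (fst c) \<le> length (fst a)" if "c \<in> set p" for c
    using that by (auto simp: m_def)
  obtain qs rs where split: "p = qs @ a # rs" using a(1) by (meson split_list)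
  define q where "q = rs @ qs"
  have q: "cas (head D a) q (tail D a)"
    using p(1) unfolding split q_def cas_app cas.simps by blast
  have avoid: "fst c \<noteq> fst a \<and> fst a \<noteq> tl (fst c)" if "c \<in> set q" for c
  proof -
    have "c \<in> set p" using that unfolding split q_def by auto
    moreover have "fst c \<noteq> fst a"
      using that p(3) unfolding split q_def by (fastforce simp: image_iff)
    moreover have "fst c \<noteq> []"
      using \<open>c \<in> set p\<close> p(4) by (auto simp: D_def doubled_def word_tree_def)
    moreover have "length (fst c) \<le> length (fst a)" by (rule max) fact
    ultimately show ?thesis by (cases "fst c") auto
  qed
  have aD: "a \<in> arcs D" and ne: "fst a \<noteq> []"
    using a(1) p(4) by (auto simp: D_def doubled_def word_tree_def)
  have "fst a \<noteq> tl (fst a)" using ne by (cases "fst a") auto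
  then have "tail D a \<noteq> head D a" using ends[OF aD] by (auto simp: doubleton_eq_iff)
  then have "q \<noteq> []" using q by auto
  have qD: "c \<in> arcs D" if "c \<in> set q" for c using that p(4) unfolding split q_def by auto
  consider "head D a = fst a" | "tail D a = fst a"
    using ends[OF aD] by (auto simp: doubleton_eq_iff)
  then show False
  proof cases
    case 1
    obtain c r where c: "q = c # r" using \<open>q \<noteq> []\<close> by (cases q) auto
    then have "tail D c = fst a" using q 1 by auto
    then show False using ends[OF qD, of c] avoid[of c] c by (auto simp: doubleton_eq_iff)
  next
    case 2
    obtain c r where c: "q = r @ [c]" using \<open>q \<noteq> []\<close> by (cases q rule: rev_cases) auto
    then have "head D c = fst a" using q 2 by (auto simp: cas_app)
    then show False using ends[OF qD, of c] avoid[of c] c by (auto simp: doubleton_eq_iff)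
  qed
qed

lemma universal_covering_word_tree:
  assumes "n \<ge> 1"
  shows "universal_covering (word_tree n) (kronecker n) (\<lambda>w. if even (length w) then 1 else 2) hd"
proof -
  have star: "\<exists>!e. e \<in> arcs (word_tree n) \<and>
      (tail (word_tree n) e = x \<or> head (word_tree n) e = x) \<and> hd e = i"
    if x: "x \<in> verts (word_tree n)" and i: "i \<in> {1..n}" for x i
  proof -
    have ends: "tail (word_tree n) e = x \<or> head (word_tree n) e = x \<longleftrightarrow> e = x \<or> tl e = x" for e
      by (auto simp: word_tree_def)
    define e where "e = (if x \<noteq> [] \<and> hd x = i then x else i # x)"
    show ?thesis
    proof (rule ex1I[of _ e])
      show "e \<in> arcs (word_tree n) \<and>
          (tail (word_tree n) e = x \<or> head (word_tree n) e = x) \<and> hd e = i"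
        unfolding ends using x i
        by (auto simp: e_def word_tree_def reduced_words_def distinct_adj_Cons)
    next
      fix e' assume "e' \<in> arcs (word_tree n) \<and>
          (tail (word_tree n) e' = x \<or> head (word_tree n) e' = x) \<and> hd e' = i"
      then have "e' \<in> reduced_words n" "e' \<noteq> []" "e' = x \<or> tl e' = x" "hd e' = i"
        unfolding ends by (auto simp: word_tree_def)
      then show "e' = e"
        by (cases e') (auto simp: e_def reduced_words_def distinct_adj_Cons)
    qed
  qed
  have labels: "hd ` arcs (word_tree n) \<subseteq> {1..n}"
  proof (intro image_subsetI)
    fix w assume "w \<in> arcs (word_tree n)"
    then show "hd w \<in> {1..n}" by (cases w) (auto simp: word_tree_def reduced_words_def)
  qed
  have parity: "even (length (tail (word_tree n) e)) \<and> odd (length (head (word_tree n) e))"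
    if "e \<in> arcs (word_tree n)" for e
    using that by (cases e) (auto simp: word_tree_def)
  have "tree_quiver (word_tree n)"
    unfolding tree_quiver_def using wf_word_tree connected_word_tree acyclic_word_tree by blast
  moreover have "(\<lambda>w. if even (length w) then 1 else 2) ` verts (word_tree n) \<subseteq> {1, 2::nat}"
    by auto
  moreover have "\<forall>e\<in>arcs (word_tree n).
      (if even (length (tail (word_tree n) e)) then 1 else 2) = (1::nat) \<and>
      (if even (length (head (word_tree n) e)) then 1 else 2) = (2::nat)"
    using parity by simp
  ultimately show ?thesis
    unfolding universal_covering_kronecker_iff[OF assms] using star labels
    by (intro conjI) (assumption | rule ballI)+
qed

section \<open>Representations\<close>

text \<open>
  All spaces of a representation are subspaces of one ambient vector space \<open>'a\<close> with scalar
  multiplication \<open>s\<close>. The fields are only meaningful on the vertices and arcs of the quiver, and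
  \<open>rep_map M e\<close> only on the space at the tail of \<open>e\<close>.
\<close>

record ('v, 'e, 'a) quiver_rep =
  rep_space :: "'v \<Rightarrow> 'a set"
  rep_map :: "'e \<Rightarrow> 'a \<Rightarrow> 'a"

definition fin_dim_subspace :: "('k::field \<Rightarrow> 'a::ab_group_add \<Rightarrow> 'a) \<Rightarrow> 'a set \<Rightarrow> bool" where
  "fin_dim_subspace s V \<longleftrightarrow> module.subspace s V \<and> (\<exists>B. finite B \<and> V = module.span s B)"

definition linear_map_on ::
  "('k::field \<Rightarrow> 'a::ab_group_add \<Rightarrow> 'a) \<Rightarrow> 'a set \<Rightarrow> 'a set \<Rightarrow> ('a \<Rightarrow> 'a) \<Rightarrow> bool" where
  "linear_map_on s V W f \<longleftrightarrow> f ` V \<subseteq> W \<and>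
     (\<forall>u\<in>V. \<forall>v\<in>V. f (u + v) = f u + f v) \<and> (\<forall>c. \<forall>v\<in>V. f (s c v) = s c (f v))"

definition mod_rep ::
  "('k::field \<Rightarrow> 'a::ab_group_add \<Rightarrow> 'a) \<Rightarrow> ('v, 'e) pre_digraph \<Rightarrow> ('v, 'e, 'a) quiver_rep set" where
  "mod_rep s Q = {M.
     (\<forall>x\<in>verts Q. fin_dim_subspace s (rep_space M x)) \<and>
     (\<forall>e\<in>arcs Q. linear_map_on s (rep_space M (tail Q e)) (rep_space M (head Q e)) (rep_map M e)) \<and>
     finite {x \<in> verts Q. rep_space M x \<noteq> {0}}}"

definition is_subrep ::
  "('k::field \<Rightarrow> 'a::ab_group_add \<Rightarrow> 'a) \<Rightarrow> ('v, 'e) pre_digraph \<Rightarrow>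
     ('v \<Rightarrow> 'a set) \<Rightarrow> ('v, 'e, 'a) quiver_rep \<Rightarrow> bool" where
  "is_subrep s Q U M \<longleftrightarrow>
     (\<forall>x\<in>verts Q. module.subspace s (U x) \<and> U x \<subseteq> rep_space M x) \<and>
     (\<forall>e\<in>arcs Q. rep_map M e ` U (tail Q e) \<subseteq> U (head Q e))"

definition indecomposable_rep ::
  "('k::field \<Rightarrow> 'a::ab_group_add \<Rightarrow> 'a) \<Rightarrow> ('v, 'e) pre_digraph \<Rightarrow> ('v, 'e, 'a) quiver_rep \<Rightarrow> bool"
where
  "indecomposable_rep s Q M \<longleftrightarrow>
     (\<exists>x\<in>verts Q. rep_space M x \<noteq> {0}) \<and>
     (\<forall>U W. is_subrep s Q U M \<and> is_subrep s Q W M \<and>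
        (\<forall>x\<in>verts Q. U x \<inter> W x = {0} \<and> {u + w | u w. u \<in> U x \<and> w \<in> W x} = rep_space M x) \<longrightarrow>
        (\<forall>x\<in>verts Q. U x = {0}) \<or> (\<forall>x\<in>verts Q. W x = {0}))"

section \<open>Push-down and constant rank\<close>

text \<open>
  The direct sum of the spaces in a fibre is the space of finitely supported families
  \<open>\<phi> :: 'v \<Rightarrow> 'a\<close>, with the pointwise scalar multiplication.
\<close>

definition fun_scale :: "('k \<Rightarrow> 'a \<Rightarrow> 'a) \<Rightarrow> 'k \<Rightarrow> ('v \<Rightarrow> 'a) \<Rightarrow> 'v \<Rightarrow> 'a" where
  "fun_scale s c \<phi> = (\<lambda>y. s c (\<phi> y))"

definition push_down ::
  "('v, 'e) pre_digraph \<Rightarrow> ('v \<Rightarrow> nat) \<Rightarrow> ('e \<Rightarrow> nat) \<Rightarrow> ('v, 'e, 'a::ab_group_add) quiver_rep \<Rightarrow>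
     (nat, nat, 'v \<Rightarrow> 'a) quiver_rep" where
  "push_down Q \<pi>\<^sub>0 \<pi>\<^sub>1 M = \<lparr>
     rep_space = (\<lambda>j. {\<phi>. finite {y. \<phi> y \<noteq> 0} \<and>
        (\<forall>y. if y \<in> verts Q \<and> \<pi>\<^sub>0 y = j then \<phi> y \<in> rep_space M y else \<phi> y = 0)}),
     rep_map = (\<lambda>i \<phi> z. \<Sum>e | e \<in> arcs Q \<and> \<pi>\<^sub>1 e = i \<and> head Q e = z.
        rep_map M e (\<phi> (tail Q e))) \<rparr>"

lemma vector_space_fun_scale:
  assumes "vector_space s"
  shows "vector_space (fun_scale s)"
proof -
  interpret vector_space s by (rule assms)
  show ?thesis
    by unfold_locales (auto simp: fun_scale_def fun_eq_iff scale_right_distrib scale_left_distrib)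
qed

definition constant_rank ::
  "('k::field \<Rightarrow> 'b::ab_group_add \<Rightarrow> 'b) \<Rightarrow> nat \<Rightarrow> (nat, nat, 'b) quiver_rep \<Rightarrow> bool" where
  "constant_rank s n N \<longleftrightarrow> (\<exists>r. \<forall>\<alpha>. (\<exists>i\<in>{1..n}. \<alpha> i \<noteq> 0) \<longrightarrow>
     vector_space.dim s ((\<lambda>v. \<Sum>i=1..n. s (\<alpha> i) (rep_map N i v)) ` rep_space N 1) = r)"

definition Inj_reps ::
  "('k::field \<Rightarrow> 'a::ab_group_add \<Rightarrow> 'a) \<Rightarrow> ('v, 'e) pre_digraph \<Rightarrow> ('v, 'e, 'a) quiver_rep set" where
  "Inj_reps s Q = {M \<in> mod_rep s Q. \<forall>e\<in>arcs Q. inj_on (rep_map M e) (rep_space M (tail Q e))}"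

definition Surj_reps ::
  "('k::field \<Rightarrow> 'a::ab_group_add \<Rightarrow> 'a) \<Rightarrow> ('v, 'e) pre_digraph \<Rightarrow> ('v, 'e, 'a) quiver_rep set" where
  "Surj_reps s Q = {M \<in> mod_rep s Q.
     \<forall>e\<in>arcs Q. rep_map M e ` rep_space M (tail Q e) = rep_space M (head Q e)}"

definition GR_reps ::
  "('k::field \<Rightarrow> 'a::ab_group_add \<Rightarrow> 'a) \<Rightarrow> nat \<Rightarrow> ('v, 'e) pre_digraph \<Rightarrow>
     ('v \<Rightarrow> nat) \<Rightarrow> ('e \<Rightarrow> nat) \<Rightarrow> ('v, 'e, 'a) quiver_rep set" where
  "GR_reps s n Q \<pi>\<^sub>0 \<pi>\<^sub>1 = {M \<in> mod_rep s Q. constant_rank (fun_scale s) n (push_down Q \<pi>\<^sub>0 \<pi>\<^sub>1 M)}"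

end

theory Submission
  imports Defs
begin

text \<open>
  Let \<open>\<xi>\<^sub>A\<close> be the sum of the arrows of the push-down with label in \<open>A\<close>. If all maps of \<open>M\<close> are
  injective (surjective), a vertex of extremal height in a finite support, for a potential that
  only jumps along one label, shows that every nonzero combination of the arrows is injective
  (surjective).

  Conversely, let the rank be constant and fix two labels \<open>i\<close>, \<open>l\<close>. The values of \<open>ker \<xi>\<^sub>A\<close> at the
  sources, together with the vectors at a single sink that lie in \<open>im \<xi>\<^sub>A\<close>, where \<open>A = {i, l}\<close>, turn
  out to form a subrepresentation \<open>U\<close> that does not depend on the pair \<open>A\<close>. The maps of \<open>U\<close> are
  surjective and those of \<open>M / U\<close> are injective. On a tree such an extension splits, so
  indecomposability forces \<open>U = 0\<close> or \<open>U = M\<close>. The independence of \<open>A\<close> and the two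
  properties of \<open>U\<close> rest on a deformation argument: if \<open>\<xi>\<^sub>A\<close> and \<open>\<xi>\<close> for \<open>A \<union> {j}\<close>, \<open>j \<notin> A\<close>, have
  equal rank, then every element of \<open>ker \<xi>\<^sub>A\<close> that is homogeneous for a potential jumping along \<open>j\<close>
  is the lowest term of an element of the larger kernel.
\<close>

section \<open>Linear algebra\<close>

definition complement_in ::
  "('k::field \<Rightarrow> 'a::ab_group_add \<Rightarrow> 'a) \<Rightarrow> 'a set \<Rightarrow> 'a set \<Rightarrow> 'a set \<Rightarrow> bool" where
  "complement_in s V U W \<longleftrightarrow>
     module.subspace s W \<and> W \<subseteq> V \<and> U \<inter> W = {0} \<and> {u + w | u w. u \<in> U \<and> w \<in> W} = V"

context vector_space
begin

text \<open>A basis \<open>B\<close> of \<open>U\<close> is extended to a maximal independent subset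
  \<open>C\<close> of \<open>V\<close>; fixing \<open>B\<close> and killing \<open>C - B\<close>
  gives the projection.\<close>

lemma exists_projection:
  assumes "subspace U" "U \<subseteq> V"
  shows "\<exists>g. Vector_Spaces.linear scale scale g \<and> (\<forall>v\<in>V. g v \<in> U) \<and> (\<forall>u\<in>U. g u = u)"
proof -
  interpret vector_space_pair scale scale ..
  obtain B where B: "B \<subseteq> U" "independent B" "U \<subseteq> span B"
    by (rule maximal_independent_subset)
  from B(1) assms(2) have "B \<subseteq> V" by (rule subset_trans)
  obtain C where C: "B \<subseteq> C" "C \<subseteq> V" "independent C" "V \<subseteq> span C"
    by (rule maximal_independent_subset_extend[OF \<open>B \<subseteq> V\<close> B(2)])
  obtain g where g: "Vector_Spaces.linear scale scale g" "\<And>x. x \<in> C \<Longrightarrow> g x = (if x \<in> B then x else 0)"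
    using linear_independent_extend[OF C(3), of "\<lambda>x. if x \<in> B then x else 0"] by blast
  interpret g: Vector_Spaces.linear scale scale g by (rule g(1))
  have "g v \<in> U" if "v \<in> V" for v
  proof -
    have "v \<in> span C" using that C(4) by blast
    moreover have "subspace {x. g x \<in> U}"
      using assms(1) by (auto simp: subspace_def g.add g.scale)
    moreover have "g x \<in> U" if "x \<in> C" for x
      using that g(2) B(1) assms(1) subspace_0 by auto
    ultimately show ?thesis using span_induct[of v C "\<lambda>x. g x \<in> U"] by blast
  qed
  moreover have "g u = u" if "u \<in> U" for u
  proof -
    have "u \<in> span B" using that B(3) by blast
    moreover have "subspace {x. g x = x}" by (auto simp: subspace_def g.add g.scale)
    moreover have "g x = x" if "x \<in> B" for x using that g(2) C(1) by auto
    ultimately show ?thesis using span_induct[of u B "\<lambda>x. g x = x"] by blast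
  qed
  ultimately show ?thesis using g(1) by blast
qed

lemma exists_complement:
  assumes "subspace U" "subspace V" "U \<subseteq> V"
  obtains W where "subspace W" "W \<subseteq> V" "U \<inter> W = {0}" "{u + w | u w. u \<in> U \<and> w \<in> W} = V"
proof -
  obtain g where g: "Vector_Spaces.linear scale scale g" "\<And>v. v \<in> V \<Longrightarrow> g v \<in> U" "\<And>u. u \<in> U \<Longrightarrow> g u = u"
    using exists_projection[OF assms(1,3)] by auto
  interpret g: Vector_Spaces.linear scale scale g by (rule g(1))
  let ?W = "{w \<in> V. g w = 0}"
  have "subspace ?W"
    using assms(2) by (auto simp: subspace_def g.add g.scale)
  moreover have "U \<inter> ?W = {0}"
    using g(3) assms subspace_0 by fastforce
  moreover have "{u + w | u w. u \<in> U \<and> w \<in> ?W} = V"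
  proof
    show "{u + w | u w. u \<in> U \<and> w \<in> ?W} \<subseteq> V" using assms by (auto intro: subspace_add)
    show "V \<subseteq> {u + w | u w. u \<in> U \<and> w \<in> ?W}"
    proof
      fix v assume v: "v \<in> V"
      have "v - g v \<in> ?W"
        using v g(2)[OF v] g(3) assms by (auto intro: subspace_diff simp: g.diff)
      then have "v = g v + (v - g v) \<and> g v \<in> U \<and> v - g v \<in> ?W" using g(2)[OF v] by simp
      then show "v \<in> {u + w | u w. u \<in> U \<and> w \<in> ?W}" by blast
    qed
  qed
  ultimately show ?thesis using that by blast
qed

text \<open>If \<open>W\<close> is a complement of \<open>U + P\<close> in \<open>V\<close>, then
  \<open>P + W\<close> is a complement of \<open>U\<close>. The prescribed \<open>P\<close> will be
  the image of a complement under an incoming arrow.\<close>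

lemma exists_complement_containing:
  assumes "subspace U" "subspace V" "subspace P" "U \<subseteq> V" "P \<subseteq> V" "U \<inter> P = {0}"
  shows "\<exists>W. P \<subseteq> W \<and> complement_in scale V U W"
proof -
  let ?S = "{u + p | u p. u \<in> U \<and> p \<in> P}"
  have S: "subspace ?S" using assms by (intro subspace_sums)
  have SV: "?S \<subseteq> V" using assms by (auto intro: subspace_add)
  obtain W where W: "subspace W" "W \<subseteq> V" "?S \<inter> W = {0}" "{u + w | u w. u \<in> ?S \<and> w \<in> W} = V"
    by (rule exists_complement[OF S assms(2) SV])
  let ?W = "{p + w | p w. p \<in> P \<and> w \<in> W}"
  have "subspace ?W" using assms W by (intro subspace_sums)
  moreover have "?W \<subseteq> V" using assms(2,5) W(2) subspace_add by blast
  moreover have PW: "P \<subseteq> ?W"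
  proof
    fix p assume "p \<in> P"
    then have "p = p + 0 \<and> p \<in> P \<and> 0 \<in> W" using W(1) subspace_0 by simp
    then show "p \<in> ?W" by blast
  qed
  moreover have "U \<inter> ?W = {0}"
  proof
    show "{0} \<subseteq> U \<inter> ?W" using PW assms subspace_0 by blast
    show "U \<inter> ?W \<subseteq> {0}"
    proof
      fix u assume "u \<in> U \<inter> ?W"
      then obtain p w where u: "u \<in> U" "p \<in> P" "w \<in> W" "u = p + w" by blast
      \<comment> \<open>Solving \<open>u = p + w\<close> for \<open>w\<close> puts it into
        \<open>U + P\<close>, which meets \<open>W\<close> only in 0.\<close>
      then have "w = u + (- p) \<and> - p \<in> P" using assms(3) subspace_neg by simp
      then have "w \<in> ?S" using u(1) by blast
      then have "w = 0" using u(3) W(3) by blast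
      then show "u \<in> {0}" using u assms(6) by auto
    qed
  qed
  moreover have "{u + w | u w. u \<in> U \<and> w \<in> ?W} = V"
  proof
    show "{u + w | u w. u \<in> U \<and> w \<in> ?W} \<subseteq> V"
      using assms(2,4) \<open>?W \<subseteq> V\<close> subspace_add by blast
    show "V \<subseteq> {u + w | u w. u \<in> U \<and> w \<in> ?W}"
    proof
      fix v assume "v \<in> V"
      then have "v \<in> {u + w | u w. u \<in> ?S \<and> w \<in> W}" using W(4) by simp
      then obtain u p w where "u \<in> U" "p \<in> P" "w \<in> W" "v = u + p + w" by blast
      then have "v = u + (p + w) \<and> u \<in> U \<and> p + w \<in> ?W" by (auto simp: add.assoc)
      then show "v \<in> {u + w | u w. u \<in> U \<and> w \<in> ?W}" by blast
    qed
  qed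
  ultimately show ?thesis unfolding complement_in_def by blast
qed

lemma exists_complement_in:
  assumes "subspace U" "subspace V" "U \<subseteq> V"
  shows "\<exists>W. complement_in scale V U W"
proof -
  have "U \<inter> {0} = {0}" "{0} \<subseteq> V" using subspace_0 assms by blast+
  then show ?thesis
    using exists_complement_containing[OF assms(1,2) subspace_single_0 assms(3)] by blast
qed

section \<open>Dimension and rank\<close>

lemma subspace_eq_if_dim_eq:
  assumes "subspace U" "U \<subseteq> V" "finite B" "V \<subseteq> span B" "dim U = dim V"
  shows "U = V"
proof -
  obtain C where C: "C \<subseteq> U" "independent C" "U \<subseteq> span C" "card C = dim U"
    by (rule basis_exists)
  from C(1) assms(2) have "C \<subseteq> V" by (rule subset_trans)
  obtain D where D: "C \<subseteq> D" "D \<subseteq> V" "independent D" "V \<subseteq> span D"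
    by (rule maximal_independent_subset_extend[OF \<open>C \<subseteq> V\<close> C(2)])
  have "card D = dim V" using D basis_card_eq_dim by blast
  \<comment> \<open>Equal cardinalities identify \<open>C\<close> with its superset \<open>D\<close>
    only because \<open>D\<close> is finite.\<close>
  moreover have "finite D"
    using independent_span_bound[OF assms(3) D(3)] D(2) assms(4) by blast
  ultimately have "C = D" using D(1) C(4) assms(5) by (simp add: card_subset_eq)
  then have "V \<subseteq> U" using D(4) C(1) span_minimal[OF _ assms(1)] by blast
  then show ?thesis using assms(2) by blast
qed

lemma dim_mono_finite:
  assumes "U \<subseteq> V" "finite B" "V \<subseteq> span B"
  shows "dim U \<le> dim V"
proof -
  obtain D where D: "D \<subseteq> V" "independent D" "V \<subseteq> span D" "card D = dim V"
    by (rule basis_exists)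
  have "finite D" using independent_span_bound[OF assms(2) D(2)] D(1) assms(3) by blast
  then show ?thesis using dim_le_card[of U D] assms(1) D by auto
qed

text \<open>Since \<open>f\<close> is linear on \<open>V\<close> only, it is replaced by a globally
  linear \<open>g\<close> that agrees with it on \<open>V\<close>. A basis \<open>C\<close> of the
  kernel is extended to a basis \<open>D\<close> of \<open>V\<close>; the images of
  \<open>D - C\<close> form a basis of the span of the image.\<close>

lemma rank_nullity:
  assumes V: "subspace V" and B: "finite B" "V \<subseteq> span B"
    and f: "linear_map_on scale V UNIV f"
  shows "dim (f ` V) + dim {v \<in> V. f v = 0} = dim V"
proof -
  interpret vector_space_pair scale scale ..
  have add: "f (u + v) = f u + f v" if "u \<in> V" "v \<in> V" for u v
    using f that by (simp add: linear_map_on_def)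
  have scl: "f (scale c v) = scale c (f v)" if "v \<in> V" for c v
    using f that by (simp add: linear_map_on_def)
  have f0: "f 0 = 0" using scl[of 0 0] V subspace_0 by simp
  let ?K = "{v \<in> V. f v = 0}"
  have K: "subspace ?K"
    using V f0 by (auto simp: subspace_def add scl)
  obtain C where C: "C \<subseteq> ?K" "independent C" "?K \<subseteq> span C" "card C = dim ?K"
    by (rule basis_exists)
  from C(1) have "C \<subseteq> V" by blast
  obtain D where D: "C \<subseteq> D" "D \<subseteq> V" "independent D" "V \<subseteq> span D"
    by (rule maximal_independent_subset_extend[OF \<open>C \<subseteq> V\<close> C(2)])
  have finD: "finite D" using independent_span_bound[OF B(1) D(3)] D(2) B(2) by blast
  have cD: "card D = dim V" using D basis_card_eq_dim by blast
  have spD: "span D = V" using D span_minimal[OF _ V] by blast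
  obtain g where g: "Vector_Spaces.linear scale scale g" "\<And>x. x \<in> D \<Longrightarrow> g x = f x"
    using linear_independent_extend[OF D(3), of f] by blast
  interpret g: Vector_Spaces.linear scale scale g by (rule g(1))
  have gf: "g v = f v" if "v \<in> V" for v
  proof -
    have "subspace {v \<in> V. g v = f v}"
      using V f0 by (auto simp: subspace_def g.add g.scale add scl)
    then have "span D \<subseteq> {v \<in> V. g v = f v}" using D(2) g(2) by (intro span_minimal) auto
    then show ?thesis using that spD by blast
  qed
  let ?E = "D - C"
  \<comment> \<open>\<open>q\<close> fixes \<open>C\<close> and kills \<open>D - C\<close>, so the
    spans of these two sets meet only in 0, which makes \<open>g\<close> injective on the span of
    \<open>D - C\<close>.\<close>
  obtain q where q: "Vector_Spaces.linear scale scale q" "\<And>x. x \<in> D \<Longrightarrow> q x = (if x \<in> C then x else 0)"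
    using linear_independent_extend[OF D(3), of "\<lambda>x. if x \<in> C then x else 0"] by blast
  interpret q: Vector_Spaces.linear scale scale q by (rule q(1))
  have qC: "q v = v" if "v \<in> span C" for v
    using that
  proof (rule span_induct)
    show "subspace {v. q v = v}" by (auto simp: subspace_def q.add q.scale)
  qed (use q(2) D(1) in auto)
  have qE: "q v = 0" if "v \<in> span ?E" for v
    using that
  proof (rule span_induct)
    show "subspace {v. q v = 0}" by (auto simp: subspace_def q.add q.scale)
  qed (use q(2) in auto)
  have inj: "inj_on g (span ?E)"
  proof -
    have "v = 0" if "v \<in> span ?E" "g v = 0" for v
    proof -
      have "v \<in> V" using that(1) span_mono[of ?E D] spD by blast
      then have "v \<in> span C" using that(2) gf C(3) by auto
      then show ?thesis using qC[of v] qE[OF that(1)] by simp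
    qed
    then show ?thesis by (meson g.inj_on_iff_eq_0 subspace_span)
  qed
  have indE: "independent ?E" using D(3) independent_mono by blast
  have "independent (g ` ?E)"
    using indE inj by (rule g.independent_inj_on_image)
  moreover have "card (g ` ?E) = card ?E"
    using inj_on_subset[OF inj span_superset] by (rule card_image)
  moreover have "span (g ` ?E) = span (f ` V)"
  proof -
    have "g ` D \<subseteq> insert 0 (g ` ?E)" using C(1) gf by auto
    then have "span (g ` D) \<subseteq> span (g ` ?E)" using span_mono span_insert_0 by metis
    then have "span (g ` D) = span (g ` ?E)" using span_mono[of "g ` ?E" "g ` D"] by blast
    moreover have "f ` V = g ` span D" using gf spD by auto
    ultimately have "f ` V = span (g ` ?E)" by (simp add: g.span_image)
    then show ?thesis by (simp only: span_span)
  qed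
  ultimately have "dim (f ` V) = card ?E" using dim_eq_card by metis
  moreover have "card ?E + card C = card D"
    using D(1) finD by (metis add.commute card_Diff_subset card_mono finite_subset le_add_diff_inverse)
  ultimately show ?thesis using C(4) cD by simp
qed

end

section \<open>Cuts and potentials on trees\<close>

text \<open>A simple path never returns to the vertex it leaves, whereas a later arc with the same
  key would have that vertex as an endpoint. With \<open>k = fst\<close> on the doubled quiver, an
  arc and its formal inverse count as one edge.\<close>

lemma (in wf_digraph) apath_distinct_edges:
  fixes k :: "'b \<Rightarrow> 'c"
  assumes ends: "\<And>a b. a \<in> arcs G \<Longrightarrow> b \<in> arcs G \<Longrightarrow> k a = k b \<Longrightarrow> {tail G a, head G a} = {tail G b, head G b}"
  shows "apath u p v \<Longrightarrow> distinct (map k p)"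
proof (induction p arbitrary: u)
  case Nil
  then show ?case by simp
next
  case (Cons a p)
  then have a: "a \<in> arcs G" "u = tail G a" "apath (head G a) p v" "u \<notin> set (awalk_verts (head G a) p)"
    by (auto simp: apath_Cons_iff)
  have "k a \<noteq> k b" if "b \<in> set p" for b
  proof
    assume eq: "k a = k b"
    have "awalk (head G a) p v" using a(3) by (rule awalkI_apath)
    then have "b \<in> arcs G" "{tail G b, head G b} \<subseteq> set (awalk_verts (head G a) p)"
      using that by (auto simp: set_awalk_verts)
    then show False using ends[OF a(1) _ eq] a(2,4) by (metis insert_subset insertCI subsetD)
  qed
  then show ?case using Cons.IH[OF a(3)] by auto
qed

text \<open>Removing \<open>e\<close> disconnects the tree; \<open>S\<close> consists of the
  vertices that can still be reached from its tail. A simple path to the head avoiding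
  \<open>e\<close> would close up to a forbidden cycle.\<close>

lemma tree_quiver_cut:
  assumes T: "tree_quiver T" and e: "e \<in> arcs T"
  obtains S where "tail T e \<in> S" "head T e \<notin> S"
    "\<And>f. f \<in> arcs T \<Longrightarrow> f \<noteq> e \<Longrightarrow> tail T f \<in> S \<longleftrightarrow> head T f \<in> S"
proof -
  interpret T: wf_digraph T using T by (simp add: tree_quiver_def)
  define D where "D = doubled T"
  interpret D: wf_digraph D
    by unfold_locales (auto simp: D_def doubled_def split: if_splits)
  have D: "arcs D = arcs T \<times> UNIV" "verts D = verts T"
    "tail D (f, b) = (if b then tail T f else head T f)"
    "head D (f, b) = (if b then head T f else tail T f)" for f b
    by (auto simp: D_def doubled_def)
  define S where "S = {x. \<exists>p. D.awalk (tail T e) p x \<and> e \<notin> fst ` set p}"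
  have "tail T e \<in> S"
    unfolding S_def using e by (auto simp: D.awalk_Nil_iff D intro!: exI[of _ "[]"])
  moreover have "head T e \<notin> S"
  proof
    assume "head T e \<in> S"
    then obtain p where p: "D.awalk (tail T e) p (head T e)" "e \<notin> fst ` set p" by (auto simp: S_def)
    define q where "q = D.awalk_to_apath p"
    have q: "D.apath (tail T e) q (head T e)" "set q \<subseteq> set p"
      unfolding q_def using p(1) D.apath_awalk_to_apath D.awalk_to_apath_subset by blast+
    \<comment> \<open>The formal inverse of \<open>e\<close> leads from its head back to its tail,
      where \<open>q\<close> starts.\<close>
    have "D.cycle ((e, False) # q)"
      using q(1) e
      by (auto simp: D.cycle_def D.apath_def D.awalk_Cons_iff D intro!: exI[of _ "head T e"])
    moreover have "distinct (map fst q)"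
      by (rule D.apath_distinct_edges[OF _ q(1)]) (auto simp: D split: if_splits)
    ultimately show False
      using T q(2) p(2) unfolding tree_quiver_def D_def by fastforce
  qed
  moreover have step: "head D a \<in> S" if a: "a \<in> arcs D" "fst a \<noteq> e" "tail D a \<in> S" for a
  proof -
    obtain p where p: "D.awalk (tail T e) p (tail D a)" "e \<notin> fst ` set p" using a(3) by (auto simp: S_def)
    have "D.awalk (tail T e) (p @ [a]) (head D a)"
      using p(1) a(1) by (auto simp: D.awalk_append_iff D.awalk_Cons_iff D.awalk_Nil_iff)
    moreover have "e \<notin> fst ` set (p @ [a])" using p(2) a(2) by auto
    ultimately show ?thesis unfolding S_def by blast
  qed
  have "tail T f \<in> S \<longleftrightarrow> head T f \<in> S" if "f \<in> arcs T" "f \<noteq> e" for f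
    using step[of "(f, True)"] step[of "(f, False)"] that by (auto simp: D)
  ultimately show ?thesis using that by blast
qed

text \<open>Without cycles nothing obstructs prescribed jumps. For each new arc the missing amount
  is added on the head side of its cut, which changes no other jump.\<close>

lemma tree_quiver_potential:
  assumes T: "tree_quiver T" and E: "finite E" "E \<subseteq> arcs T"
  shows "\<exists>h :: 'v \<Rightarrow> int. \<forall>e\<in>E. h (head T e) = h (tail T e) + w e"
  using E
proof (induction E rule: finite_induct)
  case empty
  then show ?case by simp
next
  case (insert e E)
  then obtain h :: "'v \<Rightarrow> int" where h: "\<forall>f\<in>E. h (head T f) = h (tail T f) + w f" by auto
  obtain S where S: "tail T e \<in> S" "head T e \<notin> S"
    "\<And>f. f \<in> arcs T \<Longrightarrow> f \<noteq> e \<Longrightarrow> tail T f \<in> S \<longleftrightarrow> head T f \<in> S"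
    using tree_quiver_cut[OF T] insert.prems by blast
  let ?h = "\<lambda>x. if x \<in> S then h x else h x + (w e - (h (head T e) - h (tail T e)))"
  have "\<forall>f\<in>insert e E. ?h (head T f) = ?h (tail T f) + w f"
  proof
    fix f assume f: "f \<in> insert e E"
    show "?h (head T f) = ?h (tail T f) + w f"
    proof (cases "f = e")
      case True
      then show ?thesis using S by simp
    next
      case False
      then have "f \<in> E" "f \<in> arcs T" using f insert.prems by auto
      then show ?thesis using S(3)[of f] False h by auto
    qed
  qed
  then show ?case by (rule exI[where x = ?h])
qed

section \<open>Splitting off a surjective subrepresentation\<close>

context vector_space
begin

section \<open>Linear maps on subspaces\<close>

lemma linear_map_on_0:
  assumes "subspace V" "linear_map_on scale V W f"
  shows "f 0 = 0"
proof -
  have "f (scale 0 0) = scale 0 (f 0)"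
    using assms(2) subspace_0[OF assms(1)] unfolding linear_map_on_def by blast
  then show ?thesis by simp
qed

lemma linear_map_on_diff:
  assumes "subspace V" "linear_map_on scale V W f" "u \<in> V" "v \<in> V"
  shows "f (u - v) = f u - f v"
proof -
  have "f (u - v + v) = f (u - v) + f v"
    using assms subspace_diff[OF assms(1,3,4)] unfolding linear_map_on_def by blast
  then show ?thesis by (simp add: algebra_simps)
qed

lemma linear_map_on_subspace_image:
  assumes "subspace U" "U \<subseteq> V" "linear_map_on scale V W f"
  shows "subspace (f ` U)"
proof (rule subspaceI)
  have "linear_map_on scale U W f" using assms unfolding linear_map_on_def by blast
  then show "0 \<in> f ` U" using linear_map_on_0[OF assms(1)] subspace_0[OF assms(1)] by force
next
  fix x y assume "x \<in> f ` U" "y \<in> f ` U"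
  then obtain u v where "u \<in> U" "v \<in> U" "x = f u" "y = f v" by blast
  then have "x + y = f (u + v)" "u + v \<in> U"
    using assms(2,3) subspace_add[OF assms(1)] unfolding linear_map_on_def by (auto simp: subset_iff)
  then show "x + y \<in> f ` U" by blast
next
  fix c x assume "x \<in> f ` U"
  then obtain u where "u \<in> U" "x = f u" by blast
  then have "scale c x = f (scale c u)" "scale c u \<in> U"
    using assms(2,3) subspace_scale[OF assms(1)] unfolding linear_map_on_def by (auto simp: subset_iff)
  then show "scale c x \<in> f ` U" by blast
qed

lemma linear_map_on_subspace_vimage:
  assumes "subspace V" "subspace W'" "linear_map_on scale V W f"
  shows "subspace {v \<in> V. f v \<in> W'}"
proof -
  have "f 0 = 0" using linear_map_on_0 assms by blast
  then show ?thesis using assms unfolding subspace_def linear_map_on_def by auto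
qed

text \<open>Only elements of \<open>U\<close> are sent into \<open>U'\<close>, so the image of
  \<open>W\<close> meets \<open>U'\<close> in 0 and can be enlarged to a complement.\<close>

lemma complement_along_injection:
  assumes f: "linear_map_on scale V V' f" and V: "subspace V" "subspace V'"
    and U: "subspace U" "U \<subseteq> V" "subspace U'" "U' \<subseteq> V'"
    and inj: "\<And>v. v \<in> V \<Longrightarrow> f v \<in> U' \<Longrightarrow> v \<in> U"
    and W: "complement_in scale V U W"
  shows "\<exists>W'. complement_in scale V' U' W' \<and> f ` W \<subseteq> W'"
proof -
  have W': "subspace W" "W \<subseteq> V" "U \<inter> W = {0}" using W unfolding complement_in_def by blast+
  have P: "subspace (f ` W)" using W' f by (intro linear_map_on_subspace_image)
  have PV: "f ` W \<subseteq> V'" using W'(2) f unfolding linear_map_on_def by blast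
  have "U' \<inter> f ` W \<subseteq> {0}"
  proof
    fix y assume "y \<in> U' \<inter> f ` W"
    then obtain w where w: "w \<in> W" "y = f w" "f w \<in> U'" by blast
    then have "w \<in> U \<inter> W" using inj W'(2) by blast
    then have "w = 0" using W'(3) by blast
    then show "y \<in> {0}" using w(2) linear_map_on_0[OF V(1) f] by simp
  qed
  then have "U' \<inter> f ` W = {0}" using subspace_0[OF P] subspace_0[OF U(3)] by blast
  then show ?thesis
    using exists_complement_containing[OF U(3) V(2) P U(4) PV] by blast
qed

text \<open>Inside the preimage \<open>H\<close> of \<open>W'\<close>, choose a complement of
  \<open>U \<inter> H\<close>. Because \<open>U\<close> maps onto \<open>U'\<close>, the sum of
  \<open>U\<close> and \<open>H\<close> is all of \<open>V\<close>, so this is a complement of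
  \<open>U\<close> in \<open>V\<close> as well.\<close>

lemma complement_along_surjection:
  assumes f: "linear_map_on scale V V' f" and V: "subspace V" "subspace V'"
    and U: "subspace U" "U \<subseteq> V" "f ` U = U'"
    and W: "complement_in scale V' U' W'"
  shows "\<exists>W. complement_in scale V U W \<and> f ` W \<subseteq> W'"
proof -
  have W': "subspace W'" "W' \<subseteq> V'" "{u + w | u w. u \<in> U' \<and> w \<in> W'} = V'"
    using W unfolding complement_in_def by blast+
  define H where "H = {v \<in> V. f v \<in> W'}"
  have H: "subspace H" unfolding H_def using V(1) W'(1) f by (rule linear_map_on_subspace_vimage)
  have HV: "H \<subseteq> V" by (auto simp: H_def)
  have UH: "subspace (U \<inter> H)" using U(1) H by (rule subspace_inter)
  obtain W where W1: "subspace W" "W \<subseteq> H" "U \<inter> H \<inter> W = {0}"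
    and W2: "{u + w | u w. u \<in> U \<inter> H \<and> w \<in> W} = H"
    by (rule exists_complement[OF UH H]) auto
  have sum: "\<exists>u w. v = u + w \<and> u \<in> U \<and> w \<in> W" if v: "v \<in> V" for v
  proof -
    have "f v \<in> V'" using v f unfolding linear_map_on_def by blast
    then obtain u w where uw: "u \<in> U" "w \<in> W'" "f v = f u + w" using W'(3) U(3) by blast
    have "f (v - u) = w" using linear_map_on_diff[OF V(1) f v, of u] uw U(2) by auto
    then have "v - u \<in> H" using uw v U(2) V(1) subspace_diff unfolding H_def by blast
    then obtain u' w' where u': "u' \<in> U" "w' \<in> W" "v - u = u' + w'" using W2 by blast
    then have "v = (u + u') + w'" by (simp add: algebra_simps)
    then show ?thesis using u' subspace_add[OF U(1) uw(1)] by blast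
  qed
  have "complement_in scale V U W"
    unfolding complement_in_def
  proof (intro conjI)
    show "W \<subseteq> V" using W1(2) HV by blast
    show "U \<inter> W = {0}" using W1(2,3) by blast
    show "{u + w | u w. u \<in> U \<and> w \<in> W} = V"
    proof
      show "{u + w | u w. u \<in> U \<and> w \<in> W} \<subseteq> V"
        using U(2) W1(2) HV subspace_add[OF V(1)] by blast
    qed (use sum in blast)
  qed (rule W1(1))
  moreover have "f ` W \<subseteq> W'" using W1(2) by (auto simp: H_def)
  ultimately show ?thesis by blast
qed

text \<open>
  The complement at one vertex is prescribed so that the induction can reglue: the families on the
  two sides of a cut at a new arc are chosen independently, the second one starting from a
  complement that is compatible with the first one along that arc.
\<close>

lemma complement_family:
  assumes T: "tree_quiver T"
    and lin: "\<And>e. e \<in> arcs T \<Longrightarrow> linear_map_on scale (V (tail T e)) (V (head T e)) (f e)"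
    and V: "\<And>x. x \<in> verts T \<Longrightarrow> subspace (V x)"
    and U: "\<And>x. x \<in> verts T \<Longrightarrow> subspace (U x)" "\<And>x. x \<in> verts T \<Longrightarrow> U x \<subseteq> V x"
    and surj: "\<And>e. e \<in> arcs T \<Longrightarrow> f e ` U (tail T e) = U (head T e)"
    and inj: "\<And>e v. e \<in> arcs T \<Longrightarrow> v \<in> V (tail T e) \<Longrightarrow> f e v \<in> U (head T e) \<Longrightarrow> v \<in> U (tail T e)"
    and E: "finite E" "E \<subseteq> arcs T"
    and x: "x \<in> verts T" and W0: "complement_in scale (V x) (U x) W0"
  shows "\<exists>W. W x = W0 \<and> (\<forall>y\<in>verts T. complement_in scale (V y) (U y) (W y)) \<and>
           (\<forall>e\<in>E. f e ` W (tail T e) \<subseteq> W (head T e))"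
  using E x W0
proof (induction E arbitrary: x W0 rule: finite_induct)
  case empty
  have "\<exists>W. complement_in scale (V y) (U y) W" if "y \<in> verts T" for y
    using exists_complement_in[OF U(1)[OF that] V[OF that] U(2)[OF that]] .
  then obtain W where "\<And>y. y \<in> verts T \<Longrightarrow> complement_in scale (V y) (U y) (W y)" by metis
  then show ?case using empty by (intro exI[of _ "W(x := W0)"]) auto
next
  case (insert e E)
  interpret wf_digraph T using T by (simp add: tree_quiver_def)
  have e: "e \<in> arcs T" and E: "E \<subseteq> arcs T" using insert.prems by auto
  have tv: "tail T e \<in> verts T" and hv: "head T e \<in> verts T" using e by auto
  obtain S where S: "tail T e \<in> S" "head T e \<notin> S"
    "\<And>g. g \<in> arcs T \<Longrightarrow> g \<noteq> e \<Longrightarrow> tail T g \<in> S \<longleftrightarrow> head T g \<in> S"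
    using tree_quiver_cut[OF T e] by blast
  obtain W where W: "W x = W0" "\<And>y. y \<in> verts T \<Longrightarrow> complement_in scale (V y) (U y) (W y)"
    "\<And>g. g \<in> E \<Longrightarrow> f g ` W (tail T g) \<subseteq> W (head T g)"
    using insert.IH[OF E insert.prems(2,3)] by blast
  note [simp] = tv hv
  have noE: "g \<noteq> e" if "g \<in> E" for g using insert.hyps that by blast
  show ?case
  proof (cases "x \<in> S")
    case True
    \<comment> \<open>The prescribed vertex is on the tail side, so the family is kept there and
      carried forwards across \<open>e\<close>.\<close>
    obtain P where P: "complement_in scale (V (head T e)) (U (head T e)) P" "f e ` W (tail T e) \<subseteq> P"
      using complement_along_injection[OF lin[OF e] V V U(1) U(2) U(1) U(2) inj[OF e] W(2)[OF tv]] by auto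
    obtain W' where W': "W' (head T e) = P" "\<And>y. y \<in> verts T \<Longrightarrow> complement_in scale (V y) (U y) (W' y)"
      "\<And>g. g \<in> E \<Longrightarrow> f g ` W' (tail T g) \<subseteq> W' (head T g)"
      using insert.IH[OF E hv P(1)] by blast
    let ?W = "\<lambda>y. if y \<in> S then W y else W' y"
    have "f g ` ?W (tail T g) \<subseteq> ?W (head T g)" if "g \<in> insert e E" for g
    proof (cases "g = e")
      case True
      then show ?thesis using S P W' by simp
    next
      case False
      then have "g \<in> E" "g \<in> arcs T" using that E by auto
      then show ?thesis using S(3)[of g] False W(3)[of g] W'(3)[of g] by simp
    qed
    then show ?thesis using True W W' by (intro exI[of _ ?W]) auto
  next
    case False
    \<comment> \<open>The prescribed vertex is on the head side, so the complement is pulled back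
      across \<open>e\<close>, using that \<open>U\<close> maps onto \<open>U\<close> along
      \<open>e\<close>.\<close>
    obtain P where P: "complement_in scale (V (tail T e)) (U (tail T e)) P" "f e ` P \<subseteq> W (head T e)"
      using complement_along_surjection[OF lin[OF e] V V U(1) U(2) surj[OF e] W(2)[OF hv]] by auto
    obtain W' where W': "W' (tail T e) = P" "\<And>y. y \<in> verts T \<Longrightarrow> complement_in scale (V y) (U y) (W' y)"
      "\<And>g. g \<in> E \<Longrightarrow> f g ` W' (tail T g) \<subseteq> W' (head T g)"
      using insert.IH[OF E tv P(1)] by blast
    let ?W = "\<lambda>y. if y \<in> S then W' y else W y"
    have "f g ` ?W (tail T g) \<subseteq> ?W (head T g)" if "g \<in> insert e E" for g
    proof (cases "g = e")
      case True
      then show ?thesis using S P W' by simp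
    next
      case False
      then have "g \<in> E" "g \<in> arcs T" using that E by auto
      then show ?thesis using S(3)[of g] False W(3)[of g] W'(3)[of g] by simp
    qed
    then show ?thesis using False W W' by (intro exI[of _ ?W]) auto
  qed
qed

text \<open>The complement family turns \<open>U\<close> into a direct summand. If \<open>U\<close>
  is zero, \<open>inj\<close> says that each map of \<open>M\<close> has trivial kernel; if the
  complement is zero, \<open>U\<close> is all of \<open>M\<close> and \<open>surj\<close> applies to
  \<open>M\<close> itself.\<close>

lemma indecomposable_surj_or_inj:
  assumes T: "tree_quiver T" and M: "M \<in> mod_rep scale T" and ind: "indecomposable_rep scale T M"
    and fin: "finite {e \<in> arcs T. rep_space M (tail T e) \<noteq> {0}}"
    and U: "is_subrep scale T U M"
    and surj: "\<And>e. e \<in> arcs T \<Longrightarrow> U (head T e) \<subseteq> rep_map M e ` U (tail T e)"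
    and inj: "\<And>e v. e \<in> arcs T \<Longrightarrow> v \<in> rep_space M (tail T e) \<Longrightarrow> rep_map M e v \<in> U (head T e) \<Longrightarrow>
      v \<in> U (tail T e)"
  shows "M \<in> Inj_reps scale T \<union> Surj_reps scale T"
proof -
  interpret wf_digraph T using T by (simp add: tree_quiver_def)
  have lin: "linear_map_on scale (rep_space M (tail T e)) (rep_space M (head T e)) (rep_map M e)"
    if "e \<in> arcs T" for e using M that by (simp add: mod_rep_def)
  have V: "subspace (rep_space M x)" if "x \<in> verts T" for x
    using M that by (simp add: mod_rep_def fin_dim_subspace_def)
  have U1: "subspace (U x)" "U x \<subseteq> rep_space M x" if "x \<in> verts T" for x
    using U that by (auto simp: is_subrep_def)
  have surj': "rep_map M e ` U (tail T e) = U (head T e)" if "e \<in> arcs T" for e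
    using surj[OF that] U that unfolding is_subrep_def by blast
  obtain x where x: "x \<in> verts T" using ind by (auto simp: indecomposable_rep_def)
  obtain W0 where W0: "complement_in scale (rep_space M x) (U x) W0"
    using exists_complement_in[OF U1(1)[OF x] V[OF x] U1(2)[OF x]] by blast
  let ?E = "{e \<in> arcs T. rep_space M (tail T e) \<noteq> {0}}"
  have sub: "?E \<subseteq> arcs T" by blast
  obtain W where W: "\<And>y. y \<in> verts T \<Longrightarrow> complement_in scale (rep_space M y) (U y) (W y)"
    and WE: "\<And>e. e \<in> ?E \<Longrightarrow> rep_map M e ` W (tail T e) \<subseteq> W (head T e)"
    using complement_family[of T "rep_space M" "rep_map M" U, OF T lin V U1(1) U1(2) surj' inj fin sub x W0]
    by blast
  have WW: "subspace (W y)" "W y \<subseteq> rep_space M y" "U y \<inter> W y = {0}"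
    "{u + w | u w. u \<in> U y \<and> w \<in> W y} = rep_space M y" if "y \<in> verts T" for y
    using W[OF that] unfolding complement_in_def by blast+
  \<comment> \<open>The family is compatible along the finitely many arcs with nonzero tail space;
    along the others only 0 is mapped.\<close>
  have WE': "rep_map M e ` W (tail T e) \<subseteq> W (head T e)" if e: "e \<in> arcs T" for e
  proof (cases "e \<in> ?E")
    case True
    then show ?thesis by (rule WE)
  next
    case False
    then have "rep_space M (tail T e) = {0}" using e by blast
    then have "W (tail T e) \<subseteq> {0}" using WW(2)[of "tail T e"] e by auto
    moreover have "0 \<in> W (head T e)" using subspace_0[OF WW(1)] e by auto
    moreover have "rep_map M e 0 = 0" using linear_map_on_0[OF V lin[OF e]] e by auto
    ultimately show ?thesis by auto
  qed
  have "is_subrep scale T W M" unfolding is_subrep_def using WW(1,2) WE' by blast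
  then have "(\<forall>x\<in>verts T. U x = {0}) \<or> (\<forall>x\<in>verts T. W x = {0})"
    using ind U WW(3,4) unfolding indecomposable_rep_def by blast
  then show ?thesis
  proof
    assume U0: "\<forall>x\<in>verts T. U x = {0}"
    have "inj_on (rep_map M e) (rep_space M (tail T e))" if e: "e \<in> arcs T" for e
    proof (rule inj_onI)
      fix u v assume uv: "u \<in> rep_space M (tail T e)" "v \<in> rep_space M (tail T e)" "rep_map M e u = rep_map M e v"
      have sV: "subspace (rep_space M (tail T e))" using V e by simp
      have "rep_map M e (u - v) = 0" using linear_map_on_diff[OF sV lin[OF e] uv(1,2)] uv(3) by simp
      then have "u - v \<in> U (tail T e)"
        using inj[OF e subspace_diff[OF sV uv(1,2)]] U0 e by simp
      then show "u = v" using U0 e by simp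
    qed
    then show ?thesis using M by (simp add: Inj_reps_def)
  next
    assume W0: "\<forall>x\<in>verts T. W x = {0}"
    have "U x = rep_space M x" if "x \<in> verts T" for x
      using WW(4)[OF that] W0 that by auto
    then show ?thesis using M surj' by (auto simp: Surj_reps_def)
  qed
qed

end

section \<open>The push-down on the universal covering\<close>

lemma sum_fun_apply: "(\<Sum>i\<in>A. f i) x = (\<Sum>i\<in>A. f i x)"
  by (induction A rule: infinite_finite_induct) auto

lemma ex_max_on:
  fixes h :: "'v \<Rightarrow> int"
  assumes "finite S" "S \<noteq> {}"
  shows "\<exists>x\<in>S. \<forall>y\<in>S. h y \<le> h x"
proof -
  have "Max (h ` S) \<in> h ` S" using assms by simp
  then obtain x where "x \<in> S" "h x = Max (h ` S)" by force
  then show ?thesis using assms by (intro bexI[of _ x]) auto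
qed

definition single :: "'v \<Rightarrow> 'a \<Rightarrow> 'v \<Rightarrow> 'a::zero" where
  "single y m = (\<lambda>x. if x = y then m else 0)"

definition restrict_fam :: "('v \<Rightarrow> bool) \<Rightarrow> ('v \<Rightarrow> 'a) \<Rightarrow> 'v \<Rightarrow> 'a::zero" where
  "restrict_fam P \<phi> = (\<lambda>x. if P x then \<phi> x else 0)"

lemma single_0 [simp]: "single y 0 = 0"
  by (auto simp: single_def fun_eq_iff)

locale kronecker_cover = vector_space scale
  for scale :: "'k::field \<Rightarrow> 'a::ab_group_add \<Rightarrow> 'a" (infixr "*s" 75) +
  fixes n :: nat and T :: "('v, 'e) pre_digraph"
    and \<pi>\<^sub>0 :: "'v \<Rightarrow> nat" and \<pi>\<^sub>1 :: "'e \<Rightarrow> nat"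
    and M :: "('v, 'e, 'a) quiver_rep"
  assumes n: "1 \<le> n"
    and cov: "universal_covering T (kronecker n) \<pi>\<^sub>0 \<pi>\<^sub>1"
    and M: "M \<in> mod_rep scale T"
begin

abbreviation sp :: "'v \<Rightarrow> 'a set" where "sp \<equiv> rep_space M"
abbreviation mp :: "'e \<Rightarrow> 'a \<Rightarrow> 'a" where "mp \<equiv> rep_map M"

section \<open>Local structure of the covering\<close>

lemma tree: "tree_quiver T"
  using cov by (simp add: universal_covering_def)

sublocale wf_digraph T
  using tree by (simp add: tree_quiver_def)

sublocale F: vector_space "fun_scale scale"
  by (rule vector_space_fun_scale) (rule vector_space_axioms)

lemmas cov' = cov[unfolded universal_covering_kronecker_iff[OF n]]

lemma arc_ends: "e \<in> arcs T \<Longrightarrow> \<pi>\<^sub>0 (tail T e) = 1" "e \<in> arcs T \<Longrightarrow> \<pi>\<^sub>0 (head T e) = 2"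
  using cov' by blast+

lemma arc_label: "e \<in> arcs T \<Longrightarrow> \<pi>\<^sub>1 e \<in> {1..n}"
  using cov' by blast

lemma vert_type: "x \<in> verts T \<Longrightarrow> \<pi>\<^sub>0 x = 1 \<or> \<pi>\<^sub>0 x = 2"
  using cov' by blast

lemma star: "x \<in> verts T \<Longrightarrow> i \<in> {1..n} \<Longrightarrow>
    \<exists>!e. e \<in> arcs T \<and> (tail T e = x \<or> head T e = x) \<and> \<pi>\<^sub>1 e = i"
  using cov' by blast

lemma source_arc:
  assumes "x \<in> verts T" "\<pi>\<^sub>0 x = 1" "i \<in> {1..n}"
  obtains e where "e \<in> arcs T" "tail T e = x" "\<pi>\<^sub>1 e = i"
proof -
  obtain e where "e \<in> arcs T" "tail T e = x \<or> head T e = x" "\<pi>\<^sub>1 e = i"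
    using star[OF assms(1,3)] by blast
  then show ?thesis using that assms(2) arc_ends(2)[of e] by auto
qed

lemma sink_arc:
  assumes "x \<in> verts T" "\<pi>\<^sub>0 x = 2" "i \<in> {1..n}"
  obtains e where "e \<in> arcs T" "head T e = x" "\<pi>\<^sub>1 e = i"
proof -
  obtain e where "e \<in> arcs T" "tail T e = x \<or> head T e = x" "\<pi>\<^sub>1 e = i"
    using star[OF assms(1,3)] by blast
  then show ?thesis using that assms(2) arc_ends(1)[of e] by auto
qed

lemma tail_label_inj:
  assumes "e \<in> arcs T" "f \<in> arcs T" "tail T e = tail T f" "\<pi>\<^sub>1 e = \<pi>\<^sub>1 f"
  shows "e = f"
  using star[OF tail_in_verts[OF assms(1)] arc_label[OF assms(1)]] assms by (auto elim: ex1E)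

lemma head_label_inj:
  assumes "e \<in> arcs T" "f \<in> arcs T" "head T e = head T f" "\<pi>\<^sub>1 e = \<pi>\<^sub>1 f"
  shows "e = f"
  using star[OF head_in_verts[OF assms(1)] arc_label[OF assms(1)]] assms by (auto elim: ex1E)

lemma finite_in_arcs: "finite (in_arcs T z)"
proof (rule inj_on_finite)
  show "inj_on \<pi>\<^sub>1 (in_arcs T z)" by (rule inj_onI) (auto simp: in_arcs_def intro: head_label_inj)
  show "\<pi>\<^sub>1 ` in_arcs T z \<subseteq> {1..n}" using arc_label by (auto simp: in_arcs_def)
qed simp

lemma finite_out_arcs: "finite (out_arcs T y)"
proof (rule inj_on_finite)
  show "inj_on \<pi>\<^sub>1 (out_arcs T y)" by (rule inj_onI) (auto simp: out_arcs_def intro: tail_label_inj)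
  show "\<pi>\<^sub>1 ` out_arcs T y \<subseteq> {1..n}" using arc_label by (auto simp: out_arcs_def)
qed simp

lemma lin: "e \<in> arcs T \<Longrightarrow> linear_map_on scale (sp (tail T e)) (sp (head T e)) (mp e)"
  using M by (simp add: mod_rep_def)

lemma sp_subspace: "x \<in> verts T \<Longrightarrow> subspace (sp x)"
  using M by (simp add: mod_rep_def fin_dim_subspace_def)

lemma finite_supp: "finite {x \<in> verts T. sp x \<noteq> {0}}"
  using M by (simp add: mod_rep_def)

lemma mp_0: "e \<in> arcs T \<Longrightarrow> mp e 0 = 0"
  using linear_map_on_0[OF sp_subspace lin] by simp

lemma mp_in: "e \<in> arcs T \<Longrightarrow> m \<in> sp (tail T e) \<Longrightarrow> mp e m \<in> sp (head T e)"
  using lin unfolding linear_map_on_def by blast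

lemma mp_add: "e \<in> arcs T \<Longrightarrow> u \<in> sp (tail T e) \<Longrightarrow> v \<in> sp (tail T e) \<Longrightarrow> mp e (u + v) = mp e u + mp e v"
  using lin unfolding linear_map_on_def by blast

lemma mp_scale: "e \<in> arcs T \<Longrightarrow> u \<in> sp (tail T e) \<Longrightarrow> mp e (c *s u) = c *s mp e u"
  using lin unfolding linear_map_on_def by blast

lemma mp_diff: "e \<in> arcs T \<Longrightarrow> u \<in> sp (tail T e) \<Longrightarrow> v \<in> sp (tail T e) \<Longrightarrow> mp e (u - v) = mp e u - mp e v"
  using linear_map_on_diff[OF sp_subspace lin] by simp

lemma finite_supp_arcs: "finite {e \<in> arcs T. sp (tail T e) \<noteq> {0}}"
proof (rule finite_subset)
  show "{e \<in> arcs T. sp (tail T e) \<noteq> {0}} \<subseteq> (\<Union>y\<in>{x \<in> verts T. sp x \<noteq> {0}}. out_arcs T y)"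
    by (auto simp: out_arcs_def)
  show "finite (\<Union>y\<in>{x \<in> verts T. sp x \<noteq> {0}}. out_arcs T y)"
    using finite_supp finite_out_arcs by blast
qed

text \<open>Only the finitely many arcs that start in the support of \<open>M\<close> are
  constrained; these are the only ones along which a family can have a nonzero term.\<close>

lemma label_potential:
  obtains h :: "'v \<Rightarrow> int" where
    "\<And>e. e \<in> arcs T \<Longrightarrow> sp (tail T e) \<noteq> {0} \<Longrightarrow> h (head T e) = h (tail T e) + (if \<pi>\<^sub>1 e = i then 1 else 0)"
proof -
  have sub: "{e \<in> arcs T. sp (tail T e) \<noteq> {0}} \<subseteq> arcs T" by blast
  show ?thesis
    using tree_quiver_potential[OF tree finite_supp_arcs sub, of "\<lambda>e. if \<pi>\<^sub>1 e = i then 1 else 0"]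
      that by blast
qed

text \<open>The push-down space of the fibre over \<open>j\<close>. No finiteness condition is
  imposed, because the finite support of \<open>M\<close> already forces it.\<close>

definition fam :: "nat \<Rightarrow> ('v \<Rightarrow> 'a) set" where
  "fam j = {\<phi>. \<forall>y. if y \<in> verts T \<and> \<pi>\<^sub>0 y = j then \<phi> y \<in> sp y else \<phi> y = 0}"

lemma fam_in: "\<phi> \<in> fam j \<Longrightarrow> y \<in> verts T \<Longrightarrow> \<phi> y \<in> sp y"
  unfolding fam_def using subspace_0[OF sp_subspace] by (auto split: if_splits)

lemma fam_tail: "\<phi> \<in> fam j \<Longrightarrow> e \<in> arcs T \<Longrightarrow> \<phi> (tail T e) \<in> sp (tail T e)"
  by (intro fam_in) auto

lemma fam_supp: "\<phi> \<in> fam j \<Longrightarrow> \<phi> y \<noteq> 0 \<Longrightarrow> y \<in> verts T \<and> \<pi>\<^sub>0 y = j \<and> sp y \<noteq> {0}"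
  unfolding fam_def by (auto split: if_splits)

lemma finite_fam_supp:
  assumes "\<phi> \<in> fam j"
  shows "finite {y. \<phi> y \<noteq> 0}"
  using fam_supp[OF assms] by (intro finite_subset[OF _ finite_supp]) auto

lemma push_down_space: "rep_space (push_down T \<pi>\<^sub>0 \<pi>\<^sub>1 M) j = fam j"
  using finite_fam_supp[of _ j] by (auto simp: push_down_def fam_def)

lemma fam_subspace: "F.subspace (fam j)"
proof (rule F.subspaceI)
  fix \<phi> \<psi> assume *: "\<phi> \<in> fam j" "\<psi> \<in> fam j"
  show "\<phi> + \<psi> \<in> fam j"
    using * subspace_add[OF sp_subspace] by (auto simp: fam_def split: if_splits)
next
  fix c \<phi> assume "\<phi> \<in> fam j"
  then show "fun_scale scale c \<phi> \<in> fam j"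
    using subspace_scale[OF sp_subspace] by (auto simp: fam_def fun_scale_def split: if_splits)
qed (use subspace_0[OF sp_subspace] in \<open>auto simp: fam_def\<close>)

lemma single_fam: "y \<in> verts T \<Longrightarrow> m \<in> sp y \<Longrightarrow> single y m \<in> fam (\<pi>\<^sub>0 y)"
  using subspace_0[OF sp_subspace] by (auto simp: fam_def single_def)

lemma restrict_fam: "\<phi> \<in> fam j \<Longrightarrow> restrict_fam P \<phi> \<in> fam j"
  using subspace_0[OF sp_subspace] by (auto simp: fam_def restrict_fam_def split: if_splits)

lemma fam_generated:
  assumes "\<phi> \<in> fam j" "F.subspace R"
    and "\<And>y m. y \<in> verts T \<Longrightarrow> \<pi>\<^sub>0 y = j \<Longrightarrow> m \<in> sp y \<Longrightarrow> single y m \<in> R"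
  shows "\<phi> \<in> R"
proof -
  have "\<phi> = (\<Sum>y | \<phi> y \<noteq> 0. single y (\<phi> y))"
    using finite_fam_supp[OF assms(1)] by (auto simp: fun_eq_iff sum_fun_apply single_def)
  moreover have "single y (\<phi> y) \<in> R" if "\<phi> y \<noteq> 0" for y
    using fam_supp[OF assms(1) that] fam_in[OF assms(1)] assms(3) by blast
  ultimately show ?thesis using F.subspace_sum[OF assms(2)] by (metis (mono_tags, lifting) mem_Collect_eq)
qed

lemma fam_finite_dim:
  obtains B where "finite B" "fam j \<subseteq> F.span B"
proof -
  have "\<forall>y\<in>verts T. \<exists>B. finite B \<and> sp y = span B"
    using M by (simp add: mod_rep_def fin_dim_subspace_def)
  then obtain B where B: "\<And>y. y \<in> verts T \<Longrightarrow> finite (B y) \<and> sp y = span (B y)" by metis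
  let ?B = "\<Union>y\<in>{x \<in> verts T. sp x \<noteq> {0}}. single y ` B y"
  have "finite ?B" using finite_supp B by blast
  moreover have "\<phi> \<in> F.span ?B" if "\<phi> \<in> fam j" for \<phi>
  proof (rule fam_generated[OF that F.subspace_span])
    fix y m assume y: "y \<in> verts T" "m \<in> sp y"
    show "single y m \<in> F.span ?B"
    proof (cases "sp y = {0}")
      case True
      then have "single y m = 0" using y by (auto simp: single_def fun_eq_iff)
      then show ?thesis using F.span_zero by simp
    next
      case False
      have "m \<in> span (B y)" using y B by blast
      then show ?thesis
      proof (rule span_induct)
        have "single y (u + v) = single y u + single y v"
          "single y (c *s v) = fun_scale scale c (single y v)" for u v c
          by (auto simp: single_def fun_eq_iff fun_scale_def)
        then show "subspace {m. single y m \<in> F.span ?B}"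
          using F.span_add F.span_scale F.span_zero by (auto simp: subspace_def)
      next
        fix x assume "x \<in> B y"
        then have "single y x \<in> ?B" using False y by blast
        then show "single y x \<in> F.span ?B" by (rule F.span_base)
      qed
    qed
  qed
  ultimately show ?thesis using that by blast
qed

text \<open>The operator \<Sum> \<open>c i\<close> \<gamma>\<open>i\<close> on the push-down, with
  the sum over labels regrouped as a sum over the arcs ending at \<open>z\<close>.\<close>

definition pd :: "(nat \<Rightarrow> 'k) \<Rightarrow> ('v \<Rightarrow> 'a) \<Rightarrow> 'v \<Rightarrow> 'a" where
  "pd c \<phi> z = (\<Sum>e\<in>in_arcs T z. c (\<pi>\<^sub>1 e) *s mp e (\<phi> (tail T e)))"

lemma push_down_map:
  "(\<Sum>i=1..n. fun_scale scale (c i) (rep_map (push_down T \<pi>\<^sub>0 \<pi>\<^sub>1 M) i \<phi>)) = pd c \<phi>"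
proof
  fix z
  have "(\<Sum>i=1..n. fun_scale scale (c i) (rep_map (push_down T \<pi>\<^sub>0 \<pi>\<^sub>1 M) i \<phi>)) z =
    (\<Sum>i=1..n. \<Sum>e\<in>{e \<in> in_arcs T z. \<pi>\<^sub>1 e = i}. c (\<pi>\<^sub>1 e) *s mp e (\<phi> (tail T e)))"
    unfolding sum_fun_apply fun_scale_def push_down_def
    by (auto simp: scale_sum_right in_arcs_def intro!: sum.cong)
  also have "\<dots> = pd c \<phi> z"
    unfolding pd_def using arc_label by (intro sum.group finite_in_arcs) (auto simp: in_arcs_def)
  finally show "(\<Sum>i=1..n. fun_scale scale (c i) (rep_map (push_down T \<pi>\<^sub>0 \<pi>\<^sub>1 M) i \<phi>)) z = pd c \<phi> z" .
qed

lemma constant_rank_push_down_iff: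
  "constant_rank (fun_scale scale) n (push_down T \<pi>\<^sub>0 \<pi>\<^sub>1 M) \<longleftrightarrow>
    (\<exists>r. \<forall>c. (\<exists>i\<in>{1..n}. c i \<noteq> 0) \<longrightarrow> F.dim (pd c ` fam 1) = r)"
  unfolding constant_rank_def push_down_map push_down_space ..

lemma pd_linear: "linear_map_on (fun_scale scale) (fam 1) (fam 2) (pd c)"
  unfolding linear_map_on_def
proof (intro conjI ballI allI image_subsetI)
  fix \<phi> assume \<phi>: "\<phi> \<in> fam 1"
  show "pd c \<phi> \<in> fam 2"
    unfolding fam_def
  proof (rule CollectI, rule allI)
    fix z
    have "pd c \<phi> z \<in> sp z" if "z \<in> verts T"
      unfolding pd_def using that mp_in[OF _ fam_tail[OF \<phi>]]
      by (intro subspace_sum[OF sp_subspace] subspace_scale[OF sp_subspace]) (auto simp: in_arcs_def)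
    moreover have "pd c \<phi> z = 0" if "\<not> (z \<in> verts T \<and> \<pi>\<^sub>0 z = 2)"
    proof -
      have "in_arcs T z = {}" using that arc_ends(2) by (auto simp: in_arcs_def)
      then show ?thesis by (simp add: pd_def)
    qed
    ultimately show "if z \<in> verts T \<and> \<pi>\<^sub>0 z = 2 then pd c \<phi> z \<in> sp z else pd c \<phi> z = 0" by simp
  qed
  show "pd c (fun_scale scale a \<phi>) = fun_scale scale a (pd c \<phi>)" for a
    unfolding pd_def fun_scale_def scale_sum_right fun_eq_iff
    by (auto intro!: sum.cong simp: mp_scale fam_tail[OF \<phi>] mult.commute)
  fix \<psi> assume \<psi>: "\<psi> \<in> fam 1"
  show "pd c (\<phi> + \<psi>) = pd c \<phi> + pd c \<psi>"
    unfolding pd_def fun_eq_iff plus_fun_def sum.distrib[symmetric]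
    by (auto intro!: sum.cong simp: mp_add fam_tail[OF \<phi>] fam_tail[OF \<psi>] scale_right_distrib)
qed

lemma pd_eq_term:
  assumes "e \<in> arcs T" "head T e = z"
    and "\<And>f. f \<in> arcs T \<Longrightarrow> head T f = z \<Longrightarrow> f \<noteq> e \<Longrightarrow> c (\<pi>\<^sub>1 f) \<noteq> 0 \<Longrightarrow> \<phi> (tail T f) = 0"
  shows "pd c \<phi> z = c (\<pi>\<^sub>1 e) *s mp e (\<phi> (tail T e))"
proof -
  have "c (\<pi>\<^sub>1 f) *s mp f (\<phi> (tail T f)) = 0" if "f \<in> in_arcs T z - {e}" for f
  proof (cases "c (\<pi>\<^sub>1 f) = 0")
    case False
    then show ?thesis using assms(3)[of f] that mp_0 by (auto simp: in_arcs_def)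
  qed simp
  then have "pd c \<phi> z = (\<Sum>f\<in>{e}. c (\<pi>\<^sub>1 f) *s mp f (\<phi> (tail T f)))"
    unfolding pd_def using assms(1,2) finite_in_arcs
    by (intro sum.mono_neutral_right) (auto simp: in_arcs_def)
  then show ?thesis by simp
qed

lemma pd_single:
  assumes "y \<in> verts T"
  shows "pd c (single y m) = (\<Sum>f\<in>out_arcs T y. single (head T f) (c (\<pi>\<^sub>1 f) *s mp f m))"
proof
  fix z
  have "pd c (single y m) z = (\<Sum>f\<in>in_arcs T z. if tail T f = y then c (\<pi>\<^sub>1 f) *s mp f m else 0)"
    unfolding pd_def by (intro sum.cong) (auto simp: single_def in_arcs_def mp_0)
  also have "\<dots> = (\<Sum>f\<in>{f \<in> in_arcs T z. tail T f = y}. c (\<pi>\<^sub>1 f) *s mp f m)"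
    by (rule sum.inter_filter[symmetric]) (rule finite_in_arcs)
  also have "{f \<in> in_arcs T z. tail T f = y} = {f \<in> out_arcs T y. z = head T f}"
    by (auto simp: in_arcs_def out_arcs_def)
  also have "(\<Sum>f\<in>{f \<in> out_arcs T y. z = head T f}. c (\<pi>\<^sub>1 f) *s mp f m) =
      (\<Sum>f\<in>out_arcs T y. if z = head T f then c (\<pi>\<^sub>1 f) *s mp f m else 0)"
    by (rule sum.inter_filter) (rule finite_out_arcs)
  finally show "pd c (single y m) z = (\<Sum>f\<in>out_arcs T y. single (head T f) (c (\<pi>\<^sub>1 f) *s mp f m)) z"
    by (simp add: sum_fun_apply single_def)
qed

text \<open>Every combination with some \<open>c i\<close> nonzero is injective, so all ranks equal
  the dimension of \<open>fam 1\<close>. For a potential jumping along \<open>i\<close>, the arc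
  labelled \<open>i\<close> from a highest vertex of the support yields the only term at its
  head.\<close>

lemma constant_rank_if_Inj:
  assumes "M \<in> Inj_reps scale T"
  shows "constant_rank (fun_scale scale) n (push_down T \<pi>\<^sub>0 \<pi>\<^sub>1 M)"
proof -
  have inj: "inj_on (mp e) (sp (tail T e))" if "e \<in> arcs T" for e
    using assms that by (simp add: Inj_reps_def)
  have ker: "{\<phi> \<in> fam 1. pd c \<phi> = 0} = {0}" if i: "i \<in> {1..n}" "c i \<noteq> 0" for c i
  proof -
    have "\<phi> = 0" if \<phi>: "\<phi> \<in> fam 1" "pd c \<phi> = 0" for \<phi>
    proof (rule ccontr)
      assume "\<phi> \<noteq> 0"
      then have ne: "{y. \<phi> y \<noteq> 0} \<noteq> {}" by (auto simp: fun_eq_iff)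
      obtain h :: "'v \<Rightarrow> int" where h: "\<And>e. e \<in> arcs T \<Longrightarrow> sp (tail T e) \<noteq> {0} \<Longrightarrow>
          h (head T e) = h (tail T e) + (if \<pi>\<^sub>1 e = i then 1 else 0)"
        using label_potential[of i] by blast
      obtain y where y: "\<phi> y \<noteq> 0" "\<And>x. \<phi> x \<noteq> 0 \<Longrightarrow> h x \<le> h y"
        using ex_max_on[OF finite_fam_supp[OF \<phi>(1)] ne, of h] by blast
      have yv: "y \<in> verts T" "\<pi>\<^sub>0 y = 1" "sp y \<noteq> {0}" using fam_supp[OF \<phi>(1) y(1)] by auto
      obtain e where e: "e \<in> arcs T" "tail T e = y" "\<pi>\<^sub>1 e = i" by (rule source_arc[OF yv(1,2) i(1)])
      \<comment> \<open>Any other arc into the head of \<open>e\<close> would have to start at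
        height \<open>h y + 1\<close>, above the maximum on the support.\<close>
      have "\<phi> (tail T f) = 0" if f: "f \<in> arcs T" "head T f = head T e" "f \<noteq> e" for f
      proof (rule ccontr)
        assume nz: "\<phi> (tail T f) \<noteq> 0"
        have "\<pi>\<^sub>1 f \<noteq> i" using head_label_inj[OF f(1) e(1) f(2)] f(3) e(3) by auto
        then have "h (tail T f) = h (head T e)" using h[OF f(1)] fam_supp[OF \<phi>(1) nz] f(2) by simp
        also have "\<dots> = h y + 1" using h[OF e(1)] e yv by simp
        finally show False using y(2)[OF nz] by simp
      qed
      then have "pd c \<phi> (head T e) = c i *s mp e (\<phi> y)" using pd_eq_term[OF e(1) refl] e by simp
      then have "mp e (\<phi> y) = mp e 0" using \<phi>(2) i(2) mp_0[OF e(1)] by simp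
      moreover have "\<phi> y \<in> sp y" "0 \<in> sp y" using fam_in[OF \<phi>(1)] subspace_0[OF sp_subspace] yv by auto
      ultimately have "\<phi> y = 0" using inj[OF e(1)] e(2) by (auto dest: inj_onD)
      then show False using y(1) by simp
    qed
    moreover have "0 \<in> fam 1" "pd c 0 = 0"
      using F.subspace_0[OF fam_subspace] F.linear_map_on_0[OF fam_subspace pd_linear] by auto
    ultimately show ?thesis by blast
  qed
  obtain B where B: "finite B" "fam 1 \<subseteq> F.span B" by (rule fam_finite_dim)
  have "F.dim (pd c ` fam 1) = F.dim (fam 1)" if "i \<in> {1..n}" "c i \<noteq> 0" for c i
  proof -
    have "linear_map_on (fun_scale scale) (fam 1) UNIV (pd c)"
      using pd_linear[of c] unfolding linear_map_on_def by blast
    then have "F.dim (pd c ` fam 1) + F.dim {\<phi> \<in> fam 1. pd c \<phi> = 0} = F.dim (fam 1)"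
      using F.rank_nullity[OF fam_subspace B] by blast
    moreover have "F.dim {0 :: 'v \<Rightarrow> 'a} = 0" using F.dim_le_card[of "{0}" "{}"] by simp
    ultimately show ?thesis using ker[of i c, OF that] by simp
  qed
  then show ?thesis unfolding constant_rank_push_down_iff by blast
qed

text \<open>Every combination with some \<open>c i\<close> nonzero is onto \<open>fam 2\<close>.
  \<open>S\<close> collects the sinks carrying a vector outside the image. At a lowest one, lift the
  vector along the arc \<open>e\<close> labelled \<open>i\<close>; the other arcs from the tail of
  \<open>e\<close> end one level lower, where everything lies in the image.\<close>

lemma constant_rank_if_Surj:
  assumes "M \<in> Surj_reps scale T"
  shows "constant_rank (fun_scale scale) n (push_down T \<pi>\<^sub>0 \<pi>\<^sub>1 M)"
proof -
  have surj: "mp e ` sp (tail T e) = sp (head T e)" if "e \<in> arcs T" for e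
    using assms that by (simp add: Surj_reps_def)
  have "pd c ` fam 1 = fam 2" if i: "i \<in> {1..n}" "c i \<noteq> 0" for c i
  proof -
    define R where "R = pd c ` fam 1"
    have R: "F.subspace R"
      unfolding R_def using F.linear_map_on_subspace_image[OF fam_subspace subset_refl pd_linear] .
    define S where "S = {z \<in> verts T. \<pi>\<^sub>0 z = 2 \<and> (\<exists>w\<in>sp z. single z w \<notin> R)}"
    have "S \<subseteq> {x \<in> verts T. sp x \<noteq> {0}}"
      unfolding S_def using F.subspace_0[OF R] by auto
    then have finS: "finite S" using finite_supp finite_subset by blast
    obtain h :: "'v \<Rightarrow> int" where h: "\<And>e. e \<in> arcs T \<Longrightarrow> sp (tail T e) \<noteq> {0} \<Longrightarrow>
        h (head T e) = h (tail T e) + (if \<pi>\<^sub>1 e = i then 1 else 0)"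
      using label_potential[of i] by blast
    have "S = {}"
    proof (rule ccontr)
      assume "S \<noteq> {}"
      then obtain z where z: "z \<in> S" "\<And>x. x \<in> S \<Longrightarrow> h z \<le> h x"
        using ex_max_on[OF finS, of "\<lambda>x. - h x"] by auto
      then obtain w where w: "w \<in> sp z" "single z w \<notin> R" and zv: "z \<in> verts T" "\<pi>\<^sub>0 z = 2"
        by (auto simp: S_def)
      obtain e where e: "e \<in> arcs T" "head T e = z" "\<pi>\<^sub>1 e = i" by (rule sink_arc[OF zv i(1)])
      have "inverse (c i) *s w \<in> mp e ` sp (tail T e)"
        using surj[OF e(1)] e(2) subspace_scale[OF sp_subspace[OF zv(1)] w(1)] by simp
      then obtain m where m: "m \<in> sp (tail T e)" "mp e m = inverse (c i) *s w" by auto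
      then have "c i *s mp e m = w" using i(2) by simp
      have "w \<noteq> 0" using w(2) F.subspace_0[OF R] by auto
      then have "m \<noteq> 0" using \<open>c i *s mp e m = w\<close> mp_0[OF e(1)] by auto
      \<comment> \<open>The jump of the potential along \<open>e\<close> is known only when its tail
        space is nonzero.\<close>
      then have ne: "sp (tail T e) \<noteq> {0}" using m(1) by auto
      let ?y = "tail T e"
      have yv: "?y \<in> verts T" using e(1) by simp
      have other: "single (head T f) (c (\<pi>\<^sub>1 f) *s mp f m) \<in> R" if f: "f \<in> out_arcs T ?y - {e}" for f
      proof -
        have fa: "f \<in> arcs T" "tail T f = ?y" "f \<noteq> e" using f by (auto simp: out_arcs_def)
        have "\<pi>\<^sub>1 f \<noteq> i" using tail_label_inj[OF fa(1) e(1) fa(2)] fa(3) e(3) by auto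
        then have "h (head T f) < h z" using h[OF fa(1)] h[OF e(1) ne] fa(2) ne e by simp
        then have "head T f \<notin> S" using z(2) by force
        moreover have "c (\<pi>\<^sub>1 f) *s mp f m \<in> sp (head T f)"
          using mp_in[OF fa(1)] m(1) fa subspace_scale[OF sp_subspace] by simp
        ultimately show ?thesis using arc_ends(2)[OF fa(1)] fa(1) by (auto simp: S_def)
      qed
      have e_out: "e \<in> out_arcs T ?y" using e(1) by (simp add: out_arcs_def)
      have "pd c (single ?y m) = single z w +
          (\<Sum>f\<in>out_arcs T ?y - {e}. single (head T f) (c (\<pi>\<^sub>1 f) *s mp f m))"
        unfolding pd_single[OF yv] sum.remove[OF finite_out_arcs e_out]
        using e \<open>c i *s mp e m = w\<close> by simp
      then have "single z w = pd c (single ?y m) -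
          (\<Sum>f\<in>out_arcs T ?y - {e}. single (head T f) (c (\<pi>\<^sub>1 f) *s mp f m))" by simp
      moreover have "pd c (single ?y m) \<in> R"
        unfolding R_def using single_fam[OF yv m(1)] arc_ends(1)[OF e(1)] by simp
      moreover have "(\<Sum>f\<in>out_arcs T ?y - {e}. single (head T f) (c (\<pi>\<^sub>1 f) *s mp f m)) \<in> R"
        by (rule F.subspace_sum[OF R other])
      ultimately have "single z w \<in> R" by (simp only: F.subspace_diff[OF R])
      then show False using w(2) by simp
    qed
    then have "fam 2 \<subseteq> R" using fam_generated[OF _ R, of _ 2] unfolding S_def by blast
    moreover have "R \<subseteq> fam 2" using pd_linear[of c] unfolding R_def linear_map_on_def by blast
    ultimately show ?thesis unfolding R_def by blast
  qed
  then have "F.dim (pd c ` fam 1) = F.dim (fam 2)" if "i \<in> {1..n}" "c i \<noteq> 0" for c i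
    using that by metis
  then show ?thesis unfolding constant_rank_push_down_iff by blast
qed

end

section \<open>The subrepresentation cut out by two labels\<close>

context kronecker_cover
begin

section \<open>Kernels of sums of arrows\<close>

definition xi :: "nat set \<Rightarrow> ('v \<Rightarrow> 'a) \<Rightarrow> 'v \<Rightarrow> 'a" where
  "xi A = pd (\<lambda>i. if i \<in> A then 1 else 0)"

definition ker :: "nat set \<Rightarrow> ('v \<Rightarrow> 'a) set" where
  "ker A = {\<phi> \<in> fam 1. xi A \<phi> = 0}"

lemma xi_eq: "xi A \<phi> z = (\<Sum>e\<in>in_arcs T z. if \<pi>\<^sub>1 e \<in> A then mp e (\<phi> (tail T e)) else 0)"
  unfolding xi_def pd_def by (intro sum.cong) auto

lemma xi_linear: "linear_map_on (fun_scale scale) (fam 1) (fam 2) (xi A)"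
  unfolding xi_def by (rule pd_linear)

lemma xi_diff: "\<phi> \<in> fam 1 \<Longrightarrow> \<psi> \<in> fam 1 \<Longrightarrow> xi A (\<phi> - \<psi>) = xi A \<phi> - xi A \<psi>"
  by (rule F.linear_map_on_diff[OF fam_subspace xi_linear])

lemma xi_eq_term:
  assumes "e \<in> arcs T" "head T e = z" "\<pi>\<^sub>1 e \<in> A"
    and "\<And>f. f \<in> arcs T \<Longrightarrow> head T f = z \<Longrightarrow> f \<noteq> e \<Longrightarrow> \<pi>\<^sub>1 f \<in> A \<Longrightarrow> \<phi> (tail T f) = 0"
  shows "xi A \<phi> z = mp e (\<phi> (tail T e))"
proof -
  have "pd (\<lambda>i. if i \<in> A then 1 else 0) \<phi> z =
      (if \<pi>\<^sub>1 e \<in> A then 1 else 0) *s mp e (\<phi> (tail T e))"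
    by (rule pd_eq_term[OF assms(1,2)]) (use assms(4) in \<open>auto split: if_splits\<close>)
  then show ?thesis using assms(3) by (simp add: xi_def)
qed

lemma xi_eq_0:
  assumes "\<And>f. f \<in> arcs T \<Longrightarrow> head T f = z \<Longrightarrow> \<pi>\<^sub>1 f \<in> A \<Longrightarrow> \<phi> (tail T f) = 0"
  shows "xi A \<phi> z = 0"
  unfolding xi_eq using assms by (intro sum.neutral) (auto simp: mp_0)

lemma xi_insert: "j \<notin> A \<Longrightarrow> xi (insert j A) \<phi> z = xi A \<phi> z + xi {j} \<phi> z"
  unfolding xi_eq sum.distrib[symmetric] by (intro sum.cong) auto

text \<open>Truncation by height or by the side of a cut treats all nonzero terms at
  \<open>z\<close> alike, so it keeps or deletes the whole value there.\<close>

lemma xi_restrict: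
  assumes "\<And>f. f \<in> arcs T \<Longrightarrow> head T f = z \<Longrightarrow> \<pi>\<^sub>1 f \<in> A \<Longrightarrow> \<phi> (tail T f) \<noteq> 0 \<Longrightarrow> P (tail T f) \<longleftrightarrow> Q"
  shows "xi A (restrict_fam P \<phi>) z = (if Q then xi A \<phi> z else 0)"
proof -
  have "mp f (restrict_fam P \<phi> (tail T f)) = (if Q then mp f (\<phi> (tail T f)) else 0)"
    if "f \<in> arcs T" "head T f = z" "\<pi>\<^sub>1 f \<in> A" for f
    using assms[OF that] mp_0[OF that(1)] by (cases "\<phi> (tail T f) = 0") (auto simp: restrict_fam_def)
  then have "xi A (restrict_fam P \<phi>) z =
      (\<Sum>e\<in>in_arcs T z. if Q then (if \<pi>\<^sub>1 e \<in> A then mp e (\<phi> (tail T e)) else 0) else 0)"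
    unfolding xi_eq by (intro sum.cong) auto
  then show ?thesis unfolding xi_eq by simp
qed

lemma ker_subspace: "F.subspace (ker A)"
proof -
  have "F.subspace {0 :: 'v \<Rightarrow> 'a}" by (rule F.subspace_single_0)
  then have "F.subspace {\<phi> \<in> fam 1. xi A \<phi> \<in> {0}}"
    by (rule F.linear_map_on_subspace_vimage[OF fam_subspace _ xi_linear])
  then show ?thesis by (simp add: ker_def)
qed

lemma ker_fam: "\<phi> \<in> ker A \<Longrightarrow> \<phi> \<in> fam 1" by (simp add: ker_def)

lemma ker_xi: "\<phi> \<in> ker A \<Longrightarrow> xi A \<phi> z = 0" by (simp add: ker_def)

lemma kerI: "\<phi> \<in> fam 1 \<Longrightarrow> (\<And>z. xi A \<phi> z = 0) \<Longrightarrow> \<phi> \<in> ker A" by (simp add: ker_def fun_eq_iff)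

text \<open>
  Taking lowest terms maps the kernel for the larger label set into \<open>ker A\<close>. As the height
  filtrations of the two kernels have the same total dimension, no homogeneous element of
  \<open>ker A\<close> is missed.
\<close>

lemma lowest_term_extends:
  fixes h :: "'v \<Rightarrow> int"
  assumes dim: "F.dim (ker A) = F.dim (ker (insert j A))" and j: "j \<notin> A"
    and h: "\<And>e. e \<in> arcs T \<Longrightarrow> sp (tail T e) \<noteq> {0} \<Longrightarrow>
      h (head T e) = h (tail T e) + (if \<pi>\<^sub>1 e = j then 1 else 0)"
    and u: "u \<in> ker A" "\<And>x. u x \<noteq> 0 \<Longrightarrow> h x = k"
  shows "\<exists>\<phi>\<in>ker (insert j A). (\<forall>x. h x < k \<longrightarrow> \<phi> x = 0) \<and> (\<forall>x. h x = k \<longrightarrow> \<phi> x = u x)"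
proof -
  let ?B = "insert j A"
  \<comment> \<open>\<open>fl C k\<close> filters \<open>ker C\<close> by height, decreasingly in
    \<open>k\<close>, and \<open>pr k\<close> takes the part of height \<open>k\<close>. Since the
    kernel of \<open>pr k\<close> on \<open>fl C k\<close> is \<open>fl C (k + 1)\<close>, the image
    is the graded piece.\<close>
  define fl where "fl C k = {\<phi> \<in> ker C. \<forall>x. h x < k \<longrightarrow> \<phi> x = 0}" for C k
  define pr :: "int \<Rightarrow> ('v \<Rightarrow> 'a) \<Rightarrow> 'v \<Rightarrow> 'a" where "pr = (\<lambda>k. restrict_fam (\<lambda>x. h x = k))"
  have pr_eq: "pr k \<phi> = (\<lambda>x. if h x = k then \<phi> x else 0)" for k \<phi>
    by (simp add: pr_def restrict_fam_def)
  have fl_sub: "F.subspace (fl C k)" for C k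
    using ker_subspace[of C] unfolding fl_def F.subspace_def by (auto simp: fun_scale_def)
  have fl_fam: "fl C k \<subseteq> fam 1" for C k by (auto simp: fl_def ker_def)
  have pr_fam: "pr k ` fl C l \<subseteq> fam 1" for k C l
    using fl_fam restrict_fam unfolding pr_def by blast
  have pr_lin: "linear_map_on (fun_scale scale) (fl C l) UNIV (pr k)" for C l k
    unfolding linear_map_on_def pr_eq by (auto simp: fun_eq_iff fun_scale_def)
  obtain G where G: "finite G" "fam 1 \<subseteq> F.span G" by (rule fam_finite_dim)
  have next_level: "{\<phi> \<in> fl C k. pr k \<phi> = 0} = fl C (k + 1)" for C k
  proof -
    have "(\<forall>x. h x < k \<longrightarrow> \<phi> x = 0) \<and> pr k \<phi> = 0 \<longleftrightarrow> (\<forall>x. h x < k + 1 \<longrightarrow> \<phi> x = 0)" for \<phi>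
      unfolding pr_eq by (auto simp: fun_eq_iff le_less)
    then show ?thesis unfolding fl_def by blast
  qed
  have rn: "F.dim (pr k ` fl C k) + F.dim (fl C (k + 1)) = F.dim (fl C k)" for C k
    using F.rank_nullity[OF fl_sub G(1) _ pr_lin, of C k k] fl_fam G(2) next_level by auto
  \<comment> \<open>Arrows labelled \<open>j\<close> into a sink of height \<open>k\<close> start
    one level lower, where the family vanishes. So the level \<open>k\<close> part is killed by
    \<open>xi A\<close> alone.\<close>
  have low: "pr k ` fl ?B k \<subseteq> pr k ` fl A k" for k
  proof (rule image_subsetI)
    fix \<phi> assume "\<phi> \<in> fl ?B k"
    then have \<phi>: "\<phi> \<in> ker ?B" "\<And>x. h x < k \<Longrightarrow> \<phi> x = 0" by (auto simp: fl_def)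
    have nz: "h (head T f) = h (tail T f) + (if \<pi>\<^sub>1 f = j then 1 else 0)"
      if "f \<in> arcs T" "\<phi> (tail T f) \<noteq> 0" for f
      using h[OF that(1)] fam_supp[OF ker_fam[OF \<phi>(1)] that(2)] by blast
    have "xi A (pr k \<phi>) z = 0" for z
    proof -
      have "xi A (pr k \<phi>) z = (if h z = k then xi A \<phi> z else 0)"
        unfolding pr_def using nz j by (intro xi_restrict) auto
      moreover have "xi A \<phi> z = 0" if "h z = k"
      proof -
        have "xi {j} \<phi> z = 0"
          using nz \<phi>(2) that by (intro xi_eq_0) force
        then show ?thesis using xi_insert[OF j, of \<phi> z] ker_xi[OF \<phi>(1), of z] by simp
      qed
      ultimately show ?thesis by simp
    qed
    then have "pr k \<phi> \<in> fl A k"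
      unfolding fl_def pr_def using restrict_fam[OF ker_fam[OF \<phi>(1)]]
      by (auto intro!: kerI simp: restrict_fam_def)
    moreover have "pr k (pr k \<phi>) = pr k \<phi>" unfolding pr_eq by (simp add: fun_eq_iff)
    ultimately show "pr k \<phi> \<in> pr k ` fl A k" by (metis imageI)
  qed
  \<comment> \<open>\<open>D\<close> compares what remains of the two filtrations from level
    \<open>k\<close> on. It never increases, by \<open>low\<close>, and it is 0 at both ends, so it
    is 0 throughout and the graded pieces have equal dimension.\<close>
  define D where "D k = int (F.dim (fl A k)) - int (F.dim (fl ?B k))" for k
  have dim_low: "F.dim (pr k ` fl ?B k) \<le> F.dim (pr k ` fl A k)" for k
    using F.dim_mono_finite[OF low G(1)] pr_fam G(2) by blast
  have D_step: "D (k + 1) \<le> D k" for k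
    using rn[of k A] rn[of k ?B] dim_low[of k] unfolding D_def by linarith
  have D_mono: "D l \<le> D k" if "k \<le> l" for k l
    using that by (induction l rule: int_ge_induct) (auto intro: order_trans[OF D_step])
  \<comment> \<open>The extra 0 makes \<open>Min H\<close> and \<open>Max H\<close> meaningful even
    for empty support.\<close>
  define H where "H = insert 0 (h ` {x \<in> verts T. sp x \<noteq> {0}})"
  have H: "finite H" "H \<noteq> {}" unfolding H_def using finite_supp by auto
  have in_H: "h x \<in> H" if "\<phi> \<in> ker C" "\<phi> x \<noteq> 0" for \<phi> C x
    using fam_supp[OF ker_fam[OF that(1)] that(2)] by (auto simp: H_def)
  have low_bound: "fl C k = ker C" if "k \<le> Min H" for C k
  proof -
    have "\<phi> x = 0" if "\<phi> \<in> ker C" "h x < k" for \<phi> x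
      using in_H[OF that(1)] that(2) Min_le[OF H(1)] \<open>k \<le> Min H\<close> by force
    then show ?thesis by (auto simp: fl_def)
  qed
  have high_bound: "fl C k = {0}" if "k > Max H" for C k
  proof -
    have "\<phi> = 0" if "\<phi> \<in> ker C" "\<forall>x. h x < k \<longrightarrow> \<phi> x = 0" for \<phi>
    proof
      fix x show "\<phi> x = 0 x"
        using in_H[OF that(1)] that(2) Max_ge[OF H(1)] \<open>k > Max H\<close> by force
    qed
    then show ?thesis using F.subspace_0[OF ker_subspace] by (auto simp: fl_def)
  qed
  have D_0: "D k = 0" for k
  proof -
    have "D (min k (Min H)) = 0" unfolding D_def using low_bound dim by simp
    moreover have "D (max k (Max H + 1)) = 0" unfolding D_def using high_bound by simp
    ultimately show ?thesis using D_mono[of "min k (Min H)" k] D_mono[of k "max k (Max H + 1)"] by simp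
  qed
  have "F.dim (pr k ` fl ?B k) = F.dim (pr k ` fl A k)"
    using rn[of k A] rn[of k ?B] D_0[of k] D_0[of "k + 1"] unfolding D_def by linarith
  then have eq: "pr k ` fl ?B k = pr k ` fl A k"
    using F.subspace_eq_if_dim_eq[OF F.linear_map_on_subspace_image[OF fl_sub subset_refl pr_lin] low G(1)]
      pr_fam G(2) by blast
  have "u \<in> fl A k" unfolding fl_def using u by force
  moreover have pu: "pr k u = u" using u(2) by (auto simp: pr_eq fun_eq_iff)
  ultimately have "u \<in> pr k ` fl ?B k" unfolding eq by (metis imageI)
  then obtain \<phi> where "\<phi> \<in> fl ?B k" "u = pr k \<phi>" by blast
  then show ?thesis unfolding fl_def pr_eq by (intro bexI[of _ \<phi>]) auto
qed

section \<open>Kernel values and images at single vertices\<close>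

definition ker_at :: "nat set \<Rightarrow> 'v \<Rightarrow> 'a set" where
  "ker_at A y = (\<lambda>\<phi>. \<phi> y) ` ker A"

definition im_at :: "nat set \<Rightarrow> 'v \<Rightarrow> 'a set" where
  "im_at A z = {w \<in> sp z. \<exists>\<phi>\<in>fam 1. xi A \<phi> = single z w}"

lemma ker_at_subspace: "subspace (ker_at A y)"
proof (rule subspaceI)
  show "0 \<in> ker_at A y" using F.subspace_0[OF ker_subspace] unfolding ker_at_def by (intro image_eqI[of _ _ 0]) auto
next
  fix u v assume "u \<in> ker_at A y" "v \<in> ker_at A y"
  then obtain \<phi> \<psi> where "\<phi> \<in> ker A" "\<psi> \<in> ker A" "u = \<phi> y" "v = \<psi> y" by (auto simp: ker_at_def)
  then show "u + v \<in> ker_at A y"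
    using F.subspace_add[OF ker_subspace] unfolding ker_at_def by (intro image_eqI[of _ _ "\<phi> + \<psi>"]) auto
next
  fix c u assume "u \<in> ker_at A y"
  then obtain \<phi> where "\<phi> \<in> ker A" "u = \<phi> y" by (auto simp: ker_at_def)
  then show "c *s u \<in> ker_at A y"
    using F.subspace_scale[OF ker_subspace] unfolding ker_at_def
    by (intro image_eqI[of _ _ "fun_scale scale c \<phi>"]) (auto simp: fun_scale_def)
qed

lemma ker_at_sub: "y \<in> verts T \<Longrightarrow> ker_at A y \<subseteq> sp y"
  using fam_in ker_fam unfolding ker_at_def by blast

lemma im_at_subspace:
  assumes "z \<in> verts T"
  shows "subspace (im_at A z)"
proof -
  define R where "R = xi A ` fam 1"
  have "F.subspace R"
    unfolding R_def by (rule F.linear_map_on_subspace_image[OF fam_subspace subset_refl xi_linear])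
  moreover have "single z (u + v) = single z u + single z v"
    "single z (c *s v) = fun_scale scale c (single z v)" for u v c
    by (auto simp: single_def fun_eq_iff fun_scale_def)
  moreover have "im_at A z = {w \<in> sp z. single z w \<in> R}"
    unfolding im_at_def R_def by (auto intro!: image_eqI[OF sym])
  ultimately show ?thesis
    using sp_subspace[OF assms] by (simp add: subspace_def F.subspace_def)
qed

text \<open>A kernel element with value \<open>m\<close> is truncated to the tail side of the cut at
  \<open>e\<close>. Only \<open>e\<close> crosses the cut, so the result is zero at every sink but
  the head of \<open>e\<close>, where just the term \<open>mp e m\<close> remains.\<close>

lemma ker_at_to_im_at:
  assumes e: "e \<in> arcs T" "\<pi>\<^sub>1 e \<in> A" and m: "m \<in> ker_at A (tail T e)"
  shows "mp e m \<in> im_at A (head T e)"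
proof -
  obtain \<psi> where \<psi>: "\<psi> \<in> ker A" "m = \<psi> (tail T e)" using m by (auto simp: ker_at_def)
  obtain S where S: "tail T e \<in> S" "head T e \<notin> S"
    "\<And>f. f \<in> arcs T \<Longrightarrow> f \<noteq> e \<Longrightarrow> tail T f \<in> S \<longleftrightarrow> head T f \<in> S"
    by (rule tree_quiver_cut[OF tree e(1)]) blast
  let ?\<phi> = "restrict_fam (\<lambda>x. x \<in> S) \<psi>"
  have "xi A ?\<phi> z = single (head T e) (mp e m) z" for z
  proof (cases "z = head T e")
    case True
    have "xi A ?\<phi> (head T e) = mp e (?\<phi> (tail T e))"
      using S e by (intro xi_eq_term) (auto simp: restrict_fam_def)
    then show ?thesis using True S(1) \<psi>(2) by (simp add: single_def restrict_fam_def)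
  next
    case False
    have "xi A ?\<phi> z = (if z \<in> S then xi A \<psi> z else 0)"
      using S(3) False by (intro xi_restrict) auto
    then show ?thesis using False ker_xi[OF \<psi>(1)] by (simp add: single_def)
  qed
  moreover have "?\<phi> \<in> fam 1" using restrict_fam ker_fam[OF \<psi>(1)] by blast
  moreover have "mp e m \<in> sp (head T e)" using ker_at_sub[OF tail_in_verts[OF e(1)]] m by (intro mp_in[OF e(1)]) blast
  ultimately show ?thesis unfolding im_at_def by (auto simp: fun_eq_iff)
qed

text \<open>
  In the extension of \<open>u\<close>, the term one level above \<open>u\<close> is mapped by \<open>xi A\<close> to the negative of the
  image of \<open>u\<close> under the arrows labelled \<open>j\<close>. The cut at \<open>e\<close> singles out the contribution of \<open>e\<close>.
\<close>

lemma ker_at_to_im_at_other: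
  assumes dim: "F.dim (ker A) = F.dim (ker (insert (\<pi>\<^sub>1 e) A))"
    and e: "e \<in> arcs T" "\<pi>\<^sub>1 e \<notin> A" and m: "m \<in> ker_at A (tail T e)"
  shows "mp e m \<in> im_at A (head T e)"
proof (cases "m = 0")
  case True
  then show ?thesis using mp_0[OF e(1)] subspace_0[OF im_at_subspace] e(1) by simp
next
  case False
  define j where "j = \<pi>\<^sub>1 e"
  have dim: "F.dim (ker A) = F.dim (ker (insert j A))" and jA: "j \<notin> A"
    using dim e(2) by (simp_all add: j_def)
  let ?y = "tail T e" and ?z = "head T e"
  have ysp: "m \<in> sp ?y" using m ker_at_sub[of ?y] e(1) by auto
  \<comment> \<open>This is why \<open>m = 0\<close> was split off: the potential is known to jump
    along \<open>e\<close> only if its tail space is nonzero.\<close>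
  then have ne: "sp ?y \<noteq> {0}" using False by auto
  obtain \<psi> where \<psi>: "\<psi> \<in> ker A" "m = \<psi> ?y" using m by (auto simp: ker_at_def)
  obtain S where S: "?y \<in> S" "?z \<notin> S"
    "\<And>f. f \<in> arcs T \<Longrightarrow> f \<noteq> e \<Longrightarrow> tail T f \<in> S \<longleftrightarrow> head T f \<in> S"
    by (rule tree_quiver_cut[OF tree e(1)]) blast
  obtain h :: "'v \<Rightarrow> int" where h: "\<And>e. e \<in> arcs T \<Longrightarrow> sp (tail T e) \<noteq> {0} \<Longrightarrow>
      h (head T e) = h (tail T e) + (if \<pi>\<^sub>1 e = j then 1 else 0)"
    using label_potential[of j] by blast
  have hn: "h (head T f) = h (tail T f) + (if \<pi>\<^sub>1 f = j then 1 else 0)"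
    if "f \<in> arcs T" "\<phi> \<in> fam 1" "\<phi> (tail T f) \<noteq> 0" for f \<phi>
    using h[OF that(1)] fam_supp[OF that(2,3)] by blast
  \<comment> \<open>The truncation stays in \<open>ker A\<close>: arrows with labels in
    \<open>A\<close> preserve the height on the support of \<psi>, and none of them is
    \<open>e\<close>, so none crosses the cut.\<close>
  define u where "u = restrict_fam (\<lambda>x. x \<in> S \<and> h x = h ?y) \<psi>"
  have uk: "u \<in> ker A"
  proof (rule kerI)
    show "u \<in> fam 1" unfolding u_def using restrict_fam ker_fam[OF \<psi>(1)] by blast
    fix w
    have "xi A u w = (if w \<in> S \<and> h w = h ?y then xi A \<psi> w else 0)"
      unfolding u_def
    proof (rule xi_restrict)
      fix f assume f: "f \<in> arcs T" "head T f = w" "\<pi>\<^sub>1 f \<in> A" "\<psi> (tail T f) \<noteq> 0"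
      then have "f \<noteq> e" "\<pi>\<^sub>1 f \<noteq> j" using e(2) jA by auto
      then show "(tail T f \<in> S \<and> h (tail T f) = h ?y) = (w \<in> S \<and> h w = h ?y)"
        using S(3)[OF f(1)] hn[OF f(1) ker_fam[OF \<psi>(1)] f(4)] f(2) by simp
    qed
    then show "xi A u w = 0" using ker_xi[OF \<psi>(1)] by simp
  qed
  have uz: "h x = h ?y" if "u x \<noteq> 0" for x using that by (auto simp: u_def restrict_fam_def split: if_splits)
  have "\<exists>\<phi>\<in>ker (insert j A). (\<forall>x. h x < h ?y \<longrightarrow> \<phi> x = 0) \<and> (\<forall>x. h x = h ?y \<longrightarrow> \<phi> x = u x)"
    by (rule lowest_term_extends[OF dim jA h uk uz])
  then obtain \<phi> where \<phi>: "\<phi> \<in> ker (insert j A)"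
    "\<And>x. h x < h ?y \<Longrightarrow> \<phi> x = 0" "\<And>x. h x = h ?y \<Longrightarrow> \<phi> x = u x"
    by blast
  let ?\<chi> = "restrict_fam (\<lambda>x. x \<notin> S \<and> h x = h ?y + 1) \<phi>"
  have hz: "h ?z = h ?y + 1" using h[OF e(1) ne] by (simp add: j_def)
  have "xi A ?\<chi> w = single ?z (- mp e m) w" for w
  proof -
    have 1: "xi A ?\<chi> w = (if w \<notin> S \<and> h w = h ?y + 1 then xi A \<phi> w else 0)"
    proof (rule xi_restrict)
      fix f assume f: "f \<in> arcs T" "head T f = w" "\<pi>\<^sub>1 f \<in> A" "\<phi> (tail T f) \<noteq> 0"
      then have "f \<noteq> e" "\<pi>\<^sub>1 f \<noteq> j" using e(2) jA by auto
      then show "(tail T f \<notin> S \<and> h (tail T f) = h ?y + 1) = (w \<notin> S \<and> h w = h ?y + 1)"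
        using S(3)[OF f(1)] hn[OF f(1) ker_fam[OF \<phi>(1)] f(4)] f(2) by simp
    qed
    have 2: "xi A \<phi> w = - xi {j} \<phi> w"
      using xi_insert[OF jA] ker_xi[OF \<phi>(1)] by (simp add: eq_neg_iff_add_eq_0)
    show ?thesis
    proof (cases "w = ?z")
      case True
      have "xi {j} \<phi> ?z = mp e (\<phi> ?y)"
        using head_label_inj[OF _ e(1)] e by (intro xi_eq_term) (auto simp: j_def)
      moreover have "\<phi> ?y = m" using \<phi>(3)[of ?y] S(1) \<psi>(2) by (simp add: u_def restrict_fam_def)
      ultimately show ?thesis using 1 2 True S(2) hz by (simp add: single_def)
    next
      case False
      \<comment> \<open>Away from the head of \<open>e\<close>, a nonzero term would start on the
        head side at height \<open>h ?y\<close>, where \<phi> agrees with \<open>u\<close> and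
        \<open>u\<close> vanishes.\<close>
      have "xi {j} \<phi> w = 0" if w: "w \<notin> S" "h w = h ?y + 1"
      proof (rule xi_eq_0, rule ccontr)
        fix f assume f: "f \<in> arcs T" "head T f = w" "\<pi>\<^sub>1 f \<in> {j}" "\<phi> (tail T f) \<noteq> 0"
        have "tail T f \<notin> S" using S(3)[OF f(1)] f(2) w False by auto
        moreover have "h (tail T f) = h ?y" using hn[OF f(1) ker_fam[OF \<phi>(1)] f(4)] f w by simp
        ultimately show False using \<phi>(3) f(4) by (simp add: u_def restrict_fam_def)
      qed
      then show ?thesis using 1 2 False by (simp add: single_def)
    qed
  qed
  moreover have "?\<chi> \<in> fam 1" using restrict_fam ker_fam[OF \<phi>(1)] by blast
  moreover have "- mp e m \<in> sp ?z" using mp_in[OF e(1) ysp] subspace_neg[OF sp_subspace] e(1) by simp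
  ultimately have "- mp e m \<in> im_at A ?z" unfolding im_at_def by (auto simp: fun_eq_iff)
  then show ?thesis using subspace_neg[OF im_at_subspace, of ?z] e(1) by fastforce
qed

text \<open>Placed at the tail of \<open>e\<close>, the vector \<open>m\<close> is a family in
  \<open>ker {i}\<close> living at one vertex, hence homogeneous for the potential along
  \<open>l\<close>. An element of the larger kernel with this lowest term has the value
  \<open>m\<close> there.\<close>

lemma ker_at_if_mp_0:
  assumes dim: "F.dim (ker {i}) = F.dim (ker {l, i})" "i \<noteq> l"
    and e: "e \<in> arcs T" "\<pi>\<^sub>1 e = i" and m: "m \<in> sp (tail T e)" "mp e m = 0"
  shows "m \<in> ker_at {l, i} (tail T e)"
proof -
  have il: "l \<notin> {i}" using dim(2) by simp
  let ?u = "single (tail T e) m"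
  obtain h :: "'v \<Rightarrow> int" where h: "\<And>e. e \<in> arcs T \<Longrightarrow> sp (tail T e) \<noteq> {0} \<Longrightarrow>
      h (head T e) = h (tail T e) + (if \<pi>\<^sub>1 e = l then 1 else 0)"
    using label_potential[of l] by blast
  have uk: "?u \<in> ker {i}"
  proof (rule kerI)
    show "?u \<in> fam 1" using single_fam[OF tail_in_verts[OF e(1)] m(1)] arc_ends(1)[OF e(1)] by simp
    fix z
    have "mp f (?u (tail T f)) = 0" if f: "f \<in> arcs T" "\<pi>\<^sub>1 f = i" for f
      using tail_label_inj[OF f(1) e(1)] f e m(2) mp_0[OF f(1)] by (auto simp: single_def)
    then show "xi {i} ?u z = 0"
      unfolding xi_eq by (intro sum.neutral) auto
  qed
  have uz: "h x = h (tail T e)" if "?u x \<noteq> 0" for x using that by (auto simp: single_def split: if_splits)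
  have "\<exists>\<phi>\<in>ker {l, i}. (\<forall>x. h x < h (tail T e) \<longrightarrow> \<phi> x = 0) \<and>
      (\<forall>x. h x = h (tail T e) \<longrightarrow> \<phi> x = ?u x)"
    by (rule lowest_term_extends[OF dim(1) il h uk uz])
  then obtain \<phi> where "\<phi> \<in> ker {l, i}" "\<And>x. h x = h (tail T e) \<Longrightarrow> \<phi> x = ?u x" by blast
  then show ?thesis unfolding ker_at_def by (intro image_eqI[of _ _ \<phi>]) (auto simp: single_def)
qed

text \<open>Serves \<open>ker_at_onto_im_at\<close>: such a preimage reaches \<open>w\<close>
  through the arrow labelled \<open>i\<close> alone.\<close>

lemma preimage_avoiding:
  assumes dim: "F.dim (ker {i}) = F.dim (ker {l, i})" "i \<noteq> l"
    and e: "e \<in> arcs T" "\<pi>\<^sub>1 e = l" and w: "w \<in> im_at {l, i} (head T e)"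
  shows "\<exists>\<phi>\<in>fam 1. xi {l, i} \<phi> = single (head T e) w \<and> \<phi> (tail T e) = 0"
proof -
  let ?z = "head T e"
  have il: "l \<notin> {i}" using dim(2) by simp
  obtain h :: "'v \<Rightarrow> int" where h: "\<And>e. e \<in> arcs T \<Longrightarrow> sp (tail T e) \<noteq> {0} \<Longrightarrow>
      h (head T e) = h (tail T e) + (if \<pi>\<^sub>1 e = l then 1 else 0)"
    using label_potential[of l] by blast
  have hn: "h (head T f) = h (tail T f) + (if \<pi>\<^sub>1 f = l then 1 else 0)"
    if "f \<in> arcs T" "\<phi> \<in> fam 1" "\<phi> (tail T f) \<noteq> 0" for f \<phi>
    using h[OF that(1)] fam_supp[OF that(2,3)] by blast
  \<comment> \<open>Subtracting the kernel element that extends the lowest term raises the support until it lies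
    at or above the height of the sink, while the tail of \<open>e\<close> lies one below it.\<close>
  define Q where "Q k \<longleftrightarrow> (\<exists>\<phi>\<in>fam 1. xi {l, i} \<phi> = single ?z w \<and> (\<forall>x. h x < k \<longrightarrow> \<phi> x = 0))" for k
  obtain \<phi>\<^sub>0 where \<phi>\<^sub>0: "\<phi>\<^sub>0 \<in> fam 1" "xi {l, i} \<phi>\<^sub>0 = single ?z w" using w by (auto simp: im_at_def)
  \<comment> \<open>Including the height of the sink gives \<open>k\<^sub>0 \<le> h ?z\<close>, so
    the induction can end at the sink even when the support lies above it.\<close>
  define k\<^sub>0 where "k\<^sub>0 = Min (insert (h ?z) (h ` {x. \<phi>\<^sub>0 x \<noteq> 0}))"
  have fin: "finite (insert (h ?z) (h ` {x. \<phi>\<^sub>0 x \<noteq> 0}))" using finite_fam_supp[OF \<phi>\<^sub>0(1)] by simp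
  have "k\<^sub>0 \<le> h ?z" unfolding k\<^sub>0_def using fin by simp
  have "Q k" if "k\<^sub>0 \<le> k" "k \<le> h ?z" for k
    using that
  proof (induction k rule: int_ge_induct)
    case base
    have "\<phi>\<^sub>0 x = 0" if "h x < k\<^sub>0" for x
      using that Min_le[OF fin, of "h x"] unfolding k\<^sub>0_def by force
    then show ?case unfolding Q_def using \<phi>\<^sub>0 by blast
  next
    case (step k)
    then obtain \<phi> where \<phi>: "\<phi> \<in> fam 1" "xi {l, i} \<phi> = single ?z w" "\<And>x. h x < k \<Longrightarrow> \<phi> x = 0"
      unfolding Q_def by auto
    define u where "u = restrict_fam (\<lambda>x. h x = k) \<phi>"
    have uk: "u \<in> ker {i}"
    proof (rule kerI)
      show "u \<in> fam 1" unfolding u_def using restrict_fam \<phi>(1) by blast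
      fix v
      have "xi {i} u v = (if h v = k then xi {i} \<phi> v else 0)"
        unfolding u_def using hn[OF _ \<phi>(1)] dim(2) by (intro xi_restrict) auto
      \<comment> \<open>Arrows labelled \<open>l\<close> into \<open>v\<close> start below height
        \<open>k\<close>, where \<phi> vanishes; and \<open>v\<close> lies below the sink, so
        \<open>xi {l, i} \<phi>\<close> is zero at \<open>v\<close>.\<close>
      moreover have "xi {i} \<phi> v = 0" if "h v = k"
      proof -
        have "xi {l} \<phi> v = 0"
          using hn[OF _ \<phi>(1)] \<phi>(3) that by (intro xi_eq_0) force
        moreover have "v \<noteq> ?z" using that step.prems by auto
        ultimately show ?thesis
          using xi_insert[OF il, of \<phi> v] \<phi>(2) by (simp add: single_def)
      qed
      ultimately show "xi {i} u v = 0" by simp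
    qed
    have uz: "h x = k" if "u x \<noteq> 0" for x using that by (auto simp: u_def restrict_fam_def split: if_splits)
    have "\<exists>\<chi>\<in>ker {l, i}. (\<forall>x. h x < k \<longrightarrow> \<chi> x = 0) \<and> (\<forall>x. h x = k \<longrightarrow> \<chi> x = u x)"
      by (rule lowest_term_extends[OF dim(1) il h uk uz])
    then obtain \<chi> where \<chi>: "\<chi> \<in> ker {l, i}" "\<And>x. h x < k \<Longrightarrow> \<chi> x = 0" "\<And>x. h x = k \<Longrightarrow> \<chi> x = u x"
      by blast
    have "\<phi> - \<chi> \<in> fam 1" using F.subspace_diff[OF fam_subspace \<phi>(1) ker_fam[OF \<chi>(1)]] .
    moreover have "xi {l, i} (\<phi> - \<chi>) = single ?z w"
      using xi_diff[OF \<phi>(1) ker_fam[OF \<chi>(1)], of "{l, i}"] \<phi>(2) \<chi>(1) by (simp add: ker_def)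
    moreover have "(\<phi> - \<chi>) x = 0" if "h x < k + 1" for x
      using that \<phi>(3) \<chi>(2,3) by (cases "h x = k") (auto simp: u_def restrict_fam_def)
    ultimately show ?case unfolding Q_def by blast
  qed
  then obtain \<phi> where \<phi>: "\<phi> \<in> fam 1" "xi {l, i} \<phi> = single ?z w" "\<And>x. h x < h ?z \<Longrightarrow> \<phi> x = 0"
    using \<open>k\<^sub>0 \<le> h ?z\<close> unfolding Q_def by blast
  have "\<phi> (tail T e) = 0"
    using hn[OF e(1) \<phi>(1)] e(2) \<phi>(3)[of "tail T e"] by fastforce
  then show ?thesis using \<phi> by blast
qed

text \<open>One preimage of \<open>w\<close> vanishes at the tail of the arrow labelled
  \<open>l\<close>, another at the tail of \<open>e\<close>. Their difference is in the kernel, and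
  its value at the tail of \<open>e\<close> is mapped to \<open>w\<close>.\<close>

lemma ker_at_onto_im_at:
  assumes dim: "F.dim (ker {i}) = F.dim (ker {l, i})" "F.dim (ker {l}) = F.dim (ker {l, i})"
    and il: "i \<noteq> l" "l \<in> {1..n}"
    and e: "e \<in> arcs T" "\<pi>\<^sub>1 e = i"
  shows "im_at {l, i} (head T e) \<subseteq> mp e ` ker_at {l, i} (tail T e)"
proof
  fix w assume w: "w \<in> im_at {l, i} (head T e)"
  obtain f where f: "f \<in> arcs T" "head T f = head T e" "\<pi>\<^sub>1 f = l"
    by (rule sink_arc[OF head_in_verts[OF e(1)] arc_ends(2)[OF e(1)] il(2)])
  obtain \<phi> where \<phi>: "\<phi> \<in> fam 1" "xi {l, i} \<phi> = single (head T e) w" "\<phi> (tail T f) = 0"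
    using preimage_avoiding[OF dim(1) il(1) f(1,3)] w f(2) by auto
  have comm: "{i, l} = {l, i}" by blast
  obtain \<psi> where \<psi>: "\<psi> \<in> fam 1" "xi {l, i} \<psi> = single (head T e) w" "\<psi> (tail T e) = 0"
    using preimage_avoiding[of l i e w] dim(2) il(1) e w unfolding comm by auto
  have "\<phi> (tail T g) = 0" if "g \<in> arcs T" "head T g = head T e" "g \<noteq> e" "\<pi>\<^sub>1 g \<in> {l, i}" for g
  proof -
    have "\<pi>\<^sub>1 g \<noteq> i" using head_label_inj[OF that(1) e(1) that(2)] that(3) e(2) by auto
    then have "g = f" using head_label_inj[OF that(1) f(1)] that f by auto
    then show ?thesis using \<phi>(3) by simp
  qed
  then have "xi {l, i} \<phi> (head T e) = mp e (\<phi> (tail T e))"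
    using e by (intro xi_eq_term) auto
  then have "w = mp e ((\<phi> - \<psi>) (tail T e))" using \<phi>(2) \<psi>(3) by (simp add: single_def)
  moreover have "\<phi> - \<psi> \<in> ker {l, i}"
    using xi_diff[OF \<phi>(1) \<psi>(1)] F.subspace_diff[OF fam_subspace \<phi>(1) \<psi>(1)] \<phi>(2) \<psi>(2)
    by (simp add: ker_def)
  ultimately show "w \<in> mp e ` ker_at {l, i} (tail T e)" unfolding ker_at_def by blast
qed

text \<open>Some element of \<open>ker_at\<close> has the same image as \<open>m\<close>; the
  difference is killed by \<open>mp e\<close>, which is the case of
  \<open>ker_at_if_mp_0\<close>.\<close>

lemma ker_at_if_mp_in_im_at:
  assumes dim: "F.dim (ker {i}) = F.dim (ker {l, i})" "F.dim (ker {l}) = F.dim (ker {l, i})"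
    and il: "i \<noteq> l" "l \<in> {1..n}"
    and e: "e \<in> arcs T" "\<pi>\<^sub>1 e = i"
    and m: "m \<in> sp (tail T e)" "mp e m \<in> im_at {l, i} (head T e)"
  shows "m \<in> ker_at {l, i} (tail T e)"
proof -
  obtain u where u: "u \<in> ker_at {l, i} (tail T e)" "mp e m = mp e u"
    using ker_at_onto_im_at[OF dim il e] m(2) by blast
  have usp: "u \<in> sp (tail T e)" using ker_at_sub[OF tail_in_verts[OF e(1)]] u(1) by blast
  have "mp e (m - u) = 0" using mp_diff[OF e(1) m(1) usp] u(2) by simp
  then have "m - u \<in> ker_at {l, i} (tail T e)"
    using ker_at_if_mp_0[OF dim(1) il(1) e subspace_diff[OF sp_subspace m(1) usp]] e(1) by simp
  then have "m - u + u \<in> ker_at {l, i} (tail T e)" using u(1) by (rule subspace_add[OF ker_at_subspace])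
  then show ?thesis by simp
qed

section \<open>Independence of the pair of labels\<close>

definition pair_sub :: "nat set \<Rightarrow> 'v \<Rightarrow> 'a set" where
  "pair_sub A x = (if \<pi>\<^sub>0 x = 1 then ker_at A x else im_at A x)"

lemma pair_sub_tail: "e \<in> arcs T \<Longrightarrow> pair_sub A (tail T e) = ker_at A (tail T e)"
  by (simp add: pair_sub_def arc_ends)

lemma pair_sub_head: "e \<in> arcs T \<Longrightarrow> pair_sub A (head T e) = im_at A (head T e)"
  by (simp add: pair_sub_def arc_ends)

text \<open>Exchanging \<open>j\<close> and \<open>l\<close> gives the reverse inclusion, so
  replacing one label of the pair does not change the subspaces.\<close>

lemma pair_sub_mono:
  assumes dim: "\<And>A B. A \<noteq> {} \<Longrightarrow> B \<noteq> {} \<Longrightarrow> A \<subseteq> {1..n} \<Longrightarrow> B \<subseteq> {1..n} \<Longrightarrow>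
      F.dim (ker A) = F.dim (ker B)"
    and ijl: "{i, j, l} \<subseteq> {1..n}" "distinct [i, j, l]"
    and x: "x \<in> verts T"
  shows "pair_sub {i, j} x \<subseteq> pair_sub {i, l} x"
proof -
  let ?A = "{i, l}" and ?B = "{i, j}"
  have lA: "{l, i} = {i, l}" "{j, i} = {i, j}" by blast+
  note onto = ker_at_onto_im_at[of i j, unfolded lA]
  note refl_i = ker_at_if_mp_in_im_at[of i l, unfolded lA]
  note refl_l = ker_at_if_mp_in_im_at[of l i]
  \<comment> \<open>\<open>S\<close> is finite, but it is preserved by following an arrow labelled \<open>l\<close> forwards and one
    labelled \<open>i\<close> backwards, which moves off to infinity.\<close>
  define S where "S = {x \<in> verts T. \<not> pair_sub ?B x \<subseteq> pair_sub ?A x}"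
  \<comment> \<open>The label \<open>i\<close> is in both pairs: the maps are onto for
    \<open>?B\<close> and respect the subspaces for \<open>?A\<close>, so a failure at the head
    comes from one at the tail.\<close>
  have S_i: "tail T e \<in> S" if e: "e \<in> arcs T" "\<pi>\<^sub>1 e = i" "head T e \<in> S" for e
  proof -
    obtain w where w: "w \<in> im_at ?B (head T e)" "w \<notin> im_at ?A (head T e)"
      using e unfolding S_def mem_Collect_eq pair_sub_head[OF e(1)] by blast
    obtain m where m: "m \<in> ker_at ?B (tail T e)" "w = mp e m"
      using onto[OF dim dim _ _ e(1,2)] ijl w(1) by auto
    have "m \<notin> ker_at ?A (tail T e)"
      using ker_at_to_im_at[OF e(1), of ?A m] e(2) w(2) m(2) by blast
    then show ?thesis using m(1) e(1) unfolding S_def pair_sub_tail[OF e(1), symmetric] by auto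
  qed
  \<comment> \<open>The label \<open>l\<close> is outside \<open>?B\<close>, yet its maps still
    respect those subspaces by the deformation argument, and they reflect the ones for
    \<open>?A\<close>; so a failure at the tail persists at the head.\<close>
  have S_l: "head T e \<in> S" if e: "e \<in> arcs T" "\<pi>\<^sub>1 e = l" "tail T e \<in> S" for e
  proof -
    obtain m where m: "m \<in> ker_at ?B (tail T e)" "m \<notin> ker_at ?A (tail T e)"
      using e unfolding S_def mem_Collect_eq pair_sub_tail[OF e(1)] by blast
    have "mp e m \<in> im_at ?B (head T e)"
      using ker_at_to_im_at_other[OF dim e(1) _ m(1)] ijl e(2) by simp
    moreover have "m \<in> sp (tail T e)" using ker_at_sub[OF tail_in_verts[OF e(1)]] m(1) by blast
    then have "mp e m \<notin> im_at ?A (head T e)"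
      using refl_l[OF dim dim _ _ e(1,2)] m(2) ijl by auto
    ultimately show ?thesis using e(1) unfolding S_def pair_sub_head[OF e(1), symmetric] by auto
  qed
  have S_supp: "S \<subseteq> {x \<in> verts T. sp x \<noteq> {0}}"
  proof
    fix x assume x: "x \<in> S"
    then have xv: "x \<in> verts T" by (simp add: S_def)
    have "subspace (pair_sub ?A x)" "pair_sub ?B x \<subseteq> sp x"
      using ker_at_subspace im_at_subspace[OF xv] ker_at_sub[OF xv]
      by (auto simp: pair_sub_def im_at_def)
    then have "sp x \<noteq> {0}" using x subspace_0 unfolding S_def by fastforce
    then show "x \<in> {x \<in> verts T. sp x \<noteq> {0}}" using xv by simp
  qed
  then have finS: "finite S" using finite_supp finite_subset by blast
  obtain h :: "'v \<Rightarrow> int" where h: "\<And>e. e \<in> arcs T \<Longrightarrow> sp (tail T e) \<noteq> {0} \<Longrightarrow>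
      h (head T e) = h (tail T e) + (if \<pi>\<^sub>1 e = l then 1 else 0)"
    using label_potential[of l] by blast
  have i_n: "i \<in> {1..n}" and l_n: "l \<in> {1..n}" using ijl by auto
  have no_source: "\<pi>\<^sub>0 y \<noteq> 1" if "y \<in> S" for y
  proof
    assume y1: "\<pi>\<^sub>0 y = 1"
    define S' where "S' = {y \<in> S. \<pi>\<^sub>0 y = 1}"
    have S': "finite S'" "S' \<noteq> {}" using finS that y1 by (auto simp: S'_def)
    \<comment> \<open>From a highest source of \<open>S\<close>, going forwards along
      \<open>l\<close> raises the height by one and going backwards along \<open>i\<close> keeps it,
      which produces a higher source of \<open>S\<close>.\<close>
    obtain y where y: "y \<in> S" "\<pi>\<^sub>0 y = 1" "\<And>x. x \<in> S' \<Longrightarrow> h x \<le> h y"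
      using ex_max_on[OF S', of h] unfolding S'_def by blast
    have yv: "y \<in> verts T" "sp y \<noteq> {0}" using S_supp y(1) by auto
    obtain e where e: "e \<in> arcs T" "tail T e = y" "\<pi>\<^sub>1 e = l" by (rule source_arc[OF yv(1) y(2) l_n])
    have z: "head T e \<in> S" using S_l e y(1) by simp
    obtain f where f: "f \<in> arcs T" "head T f = head T e" "\<pi>\<^sub>1 f = i"
      by (rule sink_arc[OF head_in_verts[OF e(1)] arc_ends(2)[OF e(1)] i_n])
    have fS: "tail T f \<in> S" using S_i[OF f(1,3)] f(2) z by simp
    then have "sp (tail T f) \<noteq> {0}" using S_supp by blast
    then have "h (tail T f) = h (head T e)"
      using h[OF f(1)] f(2,3) ijl(2) by auto
    also have "\<dots> = h y + 1" using h[OF e(1)] e(2,3) yv(2) by simp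
    finally show False using y(3)[of "tail T f"] fS arc_ends(1)[OF f(1)] by (simp add: S'_def)
  qed
  have "S = {}"
  proof (rule ccontr)
    assume "S \<noteq> {}"
    then obtain z where z: "z \<in> S" by blast
    then have zv: "z \<in> verts T" "\<pi>\<^sub>0 z = 2" using no_source[OF z] vert_type[of z] by (auto simp: S_def)
    obtain f where f: "f \<in> arcs T" "head T f = z" "\<pi>\<^sub>1 f = i" by (rule sink_arc[OF zv i_n])
    have "tail T f \<in> S" using S_i[OF f(1,3)] f(2) z by simp
    then show False using no_source arc_ends(1)[OF f(1)] by blast
  qed
  then show ?thesis using x unfolding S_def by blast
qed

lemma Inj_or_Surj_if_constant_rank:
  assumes n3: "3 \<le> n" and ind: "indecomposable_rep scale T M"
    and cr: "constant_rank (fun_scale scale) n (push_down T \<pi>\<^sub>0 \<pi>\<^sub>1 M)"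
  shows "M \<in> Inj_reps scale T \<union> Surj_reps scale T"
proof -
  obtain r where r: "\<And>c. (\<exists>i\<in>{1..n}. c i \<noteq> 0) \<Longrightarrow> F.dim (pd c ` fam 1) = r"
    using cr unfolding constant_rank_push_down_iff by blast
  obtain B where B: "finite B" "fam 1 \<subseteq> F.span B" by (rule fam_finite_dim)
  \<comment> \<open>The coefficients of \<open>xi A\<close> are the indicator of a nonempty label
    set, so its rank is \<open>r\<close> and all these kernels have the same dimension.\<close>
  have rank: "r + F.dim (ker A) = F.dim (fam 1)" if "A \<noteq> {}" "A \<subseteq> {1..n}" for A
  proof -
    have "linear_map_on (fun_scale scale) (fam 1) UNIV (xi A)"
      using xi_linear[of A] unfolding linear_map_on_def by blast
    then have "F.dim (xi A ` fam 1) + F.dim (ker A) = F.dim (fam 1)"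
      unfolding ker_def by (rule F.rank_nullity[OF fam_subspace B])
    moreover have "F.dim (xi A ` fam 1) = r" unfolding xi_def using that by (intro r) auto
    ultimately show ?thesis by simp
  qed
  have dim: "F.dim (ker A) = F.dim (ker B)"
    if "A \<noteq> {}" "B \<noteq> {}" "A \<subseteq> {1..n}" "B \<subseteq> {1..n}" for A B
    using rank[of A] rank[of B] that by simp
  have same: "pair_sub {1, k} x = pair_sub {1, 2} x" if "k \<in> {3..n}" "x \<in> verts T" for k x
    using pair_sub_mono[OF dim _ _ that(2), of 1 k 2] pair_sub_mono[OF dim _ _ that(2), of 1 2 k] that(1) n3
    by auto
  define U where "U = pair_sub {1, 2}"
  \<comment> \<open>Every label \<open>k\<close> lies in some pair defining \<open>U\<close>, so the
    results for arcs whose label belongs to the pair cover every arc.\<close>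
  have label: "\<exists>l. l \<in> {1..n} \<and> k \<noteq> l \<and> (\<forall>x\<in>verts T. U x = pair_sub {l, k} x)" if k: "k \<in> {1..n}" for k
  proof -
    consider "k = 1" | "k = 2" | "k \<in> {3..n}" using k by force
    then show ?thesis
    proof cases
      case 1
      then show ?thesis using n3 by (intro exI[of _ 2]) (auto simp: U_def insert_commute)
    next
      case 2
      then show ?thesis using n3 by (intro exI[of _ 1]) (auto simp: U_def)
    next
      case 3
      then show ?thesis using n3 same by (intro exI[of _ 1]) (auto simp: U_def)
    qed
  qed
  have U_arc: "rep_map M e ` U (tail T e) \<subseteq> U (head T e)"
    "U (head T e) \<subseteq> rep_map M e ` U (tail T e)"
    "v \<in> sp (tail T e) \<Longrightarrow> rep_map M e v \<in> U (head T e) \<Longrightarrow> v \<in> U (tail T e)"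
    if e: "e \<in> arcs T" for e v
  proof -
    obtain l where l: "l \<in> {1..n}" "\<pi>\<^sub>1 e \<noteq> l" "\<And>x. x \<in> verts T \<Longrightarrow> U x = pair_sub {l, \<pi>\<^sub>1 e} x"
      using label[OF arc_label[OF e]] by blast
    have U: "U (tail T e) = ker_at {l, \<pi>\<^sub>1 e} (tail T e)" "U (head T e) = im_at {l, \<pi>\<^sub>1 e} (head T e)"
      using l(3) e pair_sub_tail pair_sub_head by simp_all
    have d: "F.dim (ker {\<pi>\<^sub>1 e}) = F.dim (ker {l, \<pi>\<^sub>1 e})" "F.dim (ker {l}) = F.dim (ker {l, \<pi>\<^sub>1 e})"
      using dim[of "{\<pi>\<^sub>1 e}" "{l, \<pi>\<^sub>1 e}"] dim[of "{l}" "{l, \<pi>\<^sub>1 e}"] l(1) arc_label[OF e] by auto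
    show "rep_map M e ` U (tail T e) \<subseteq> U (head T e)"
      unfolding U using ker_at_to_im_at[OF e, of "{l, \<pi>\<^sub>1 e}"] by blast
    show "U (head T e) \<subseteq> rep_map M e ` U (tail T e)"
      unfolding U by (rule ker_at_onto_im_at[OF d l(2,1) e refl])
    show "v \<in> U (tail T e)" if "v \<in> sp (tail T e)" "rep_map M e v \<in> U (head T e)"
      using that unfolding U by (rule ker_at_if_mp_in_im_at[OF d l(2,1) e refl])
  qed
  have U_sub: "subspace (U x)" "U x \<subseteq> sp x" if "x \<in> verts T" for x
    unfolding U_def pair_sub_def
    using ker_at_subspace im_at_subspace[OF that] ker_at_sub[OF that] by (auto simp: im_at_def)
  have "is_subrep scale T U M"
    unfolding is_subrep_def using U_sub U_arc(1) by blast
  then show ?thesis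
    by (rule indecomposable_surj_or_inj[OF tree M ind finite_supp_arcs _ U_arc(2,3)])
qed

end

theorem theorem1:
  fixes s :: "'k::alg_closed_field \<Rightarrow> 'a::ab_group_add \<Rightarrow> 'a"
    and n :: nat
    and T :: "('v, 'e) pre_digraph"
    and \<pi>\<^sub>0 :: "'v \<Rightarrow> nat" and \<pi>\<^sub>1 :: "'e \<Rightarrow> nat"
    and M :: "('v, 'e, 'a) quiver_rep"
  assumes "vector_space s"
    and "n \<ge> 3"
    and "universal_covering T (kronecker n) \<pi>\<^sub>0 \<pi>\<^sub>1"
    and "M \<in> mod_rep s T"
    and "indecomposable_rep s T M"
  shows "M \<in> GR_reps s n T \<pi>\<^sub>0 \<pi>\<^sub>1 \<longleftrightarrow> M \<in> Inj_reps s T \<union> Surj_reps s T"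
proof -
  interpret kronecker_cover s n T \<pi>\<^sub>0 \<pi>\<^sub>1 M
    using assms by (intro kronecker_cover.intro kronecker_cover_axioms.intro) auto
  show ?thesis
  proof
    assume "M \<in> GR_reps s n T \<pi>\<^sub>0 \<pi>\<^sub>1"
    then show "M \<in> Inj_reps s T \<union> Surj_reps s T"
      using Inj_or_Surj_if_constant_rank[OF assms(2,5)] by (simp add: GR_reps_def)
  next
    assume "M \<in> Inj_reps s T \<union> Surj_reps s T"
    then show "M \<in> GR_reps s n T \<pi>\<^sub>0 \<pi>\<^sub>1"
      using constant_rank_if_Inj constant_rank_if_Surj assms(4) by (auto simp: GR_reps_def)
  qed
qed

end
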